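(* Assume that there is a procedure which, given a Candy Crush grid $H=(V,E)$ with parameter $k$, a natural number $c>2$ and an index $t$, samples an element of $Y_t$ uniformly at random (with independent samples on repeated calls) in time polynomial in the size of the input. Then the Multilevel Splitting algorithm $\mathcal{A}$ described in the context, run with this procedure as its sampler, is a fully polynomial randomised approximation scheme (FPRAS) for approximating the number $P(H,c)$ of $k$-stable $c$-colourings of a Candy Crush grid $H$. That is, on input $(V,k,c)$, error parameter $\varepsilon>0$ and confidence parameter $0<\delta<1$, the algorithm runs in time polynomial in the size of the encoding of the input $(V,k,c)$, $\varepsilon^{-1}$ and $\log(1/\delta)$, and its estimate $\hat P=\hat\ell\, c^{|V|}$ satisfies $$\Pr\big\{(1-\varepsilon)P(H,c)\le \hat P\le (1+\varepsilon)P(H,c)\big\}\ge 1-\delta .$$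
   Context: Candy Crush grid: given natural numbers $m,n,k$, a Candy Crush grid is a $k$-uniform hypergraph $H=(V,E)$ with $V\subseteq\{1,\dots,n\}\times\{1,\dots,m\}$, whose hyperedges are all the subsets of $V$ of the form $\{(i,j),(i,j+1),\dots,(i,j+k-1)\}$ or $\{(i,j),(i+1,j),\dots,(i+k-1,j)\}$. Colourings: a $c$-colouring of $H$ is a map $\phi:V\to\{1,\dots,c\}$. A hyperedge $e$ is monochromatic under $\phi$ if $\phi$ is constant on $e$. A $k$-stable $c$-colouring (also called a weak proper $c$-colouring) is a $c$-colouring with no monochromatic hyperedge. $P(H,c)$ is the number of such colourings and $\ell=P(H,c)/c^{|V|}$. Vertices are ordered lexicographically as $v_1,v_2,\dots,v_{|V|}$: $(i,j)$ is higher than $(i',j')$ iff $i>i'$, or $i=i'$ and $j>j'$. For $0\le t\le |V|$, $Y_t$ is the set of $c$-colourings of $H$ in which none of the first $t$ vertices $v_1,\dots,v_t$ belongs to a monochromatic hyperedge. Thus $Y_0$ is the set of all $c$-colourings and $Y_{|V|}$ is the set of all $k$-stable $c$-colourings. Algorithm $\mathcal{A}$ (Multilevel Splitting). Input: $V,k,c>2,\varepsilon>0,0<\delta<1$. Let $T_{\text{sample}}=\lceil 54(|V|/\varepsilon)^2\log(2|V|/\delta)\rceil$. For each $t=1,\dots,|V|$: draw $T_{\text{sample}}$ independent uniform samples from $Y_{t-1}$, let $\mathrm{count}_t$ be the number of them lying in $Y_t$, and put $\hat c_t=\mathrm{count}_t/T_{\text{sample}}$. Output $\hat\ell=\prod_{t=1}^{|V|}\hat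 c_t$; the estimate of $P(H,c)$ is $\hat\ell\,c^{|V|}$. The vertex set $V$ is encoded as an explicit list of vertices. FPRAS: for a function $f:\Sigma^*\to\mathbb{N}$ (with $\Sigma$ a finite alphabet), an FPRAS is a randomised algorithm which, given $x\in\Sigma^*$, $\varepsilon>0$ and $0<\delta<1$, computes in time polynomial in $|x|$, $\varepsilon^{-1}$ and $\log(1/\delta)$ an estimate $\hat f(x)$ with $\Pr\{(1-\varepsilon)f(x)\le\hat f(x)\le(1+\varepsilon)f(x)\}\ge 1-\delta$.
   Formalization: The accuracy guarantee is stated for 0 < ε ≤ 1 (running time for all ε > 0); for large ε it fails, e.g. a path of 30 vertices, k = 2, c = 3, ε = 900, δ = (2/3)^29/2, where only one sample per level is drawn. *)

theory Defs
  imports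
    "HOL-Probability.Probability_Mass_Function"
    "HOL-Computational_Algebra.Polynomial"
begin

section \<open>Candy Crush grids and their colourings\<close>

type_synonym vertex = "nat \<times> nat"
type_synonym colouring = "vertex \<Rightarrow> nat"

definition grid_vertices :: "nat \<Rightarrow> nat \<Rightarrow> vertex set \<Rightarrow> bool" where
  "grid_vertices n m V \<longleftrightarrow> V \<subseteq> {1..n} \<times> {1..m}"

definition hyperedges :: "vertex set \<Rightarrow> nat \<Rightarrow> vertex set set" where
  "hyperedges V k = {e. e \<subseteq> V \<and>
     (\<exists>i j. e = {(i, j + l) | l. l < k} \<or> e = {(i + l, j) | l. l < k})}"

definition colourings :: "vertex set \<Rightarrow> nat \<Rightarrow> colouring set" where
  "colourings V c = V \<rightarrow>\<^sub>E {1..c}"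

definition monochromatic :: "colouring \<Rightarrow> vertex set \<Rightarrow> bool" where
  "monochromatic \<phi> e \<longleftrightarrow> (\<forall>u\<in>e. \<forall>v\<in>e. \<phi> u = \<phi> v)"

definition stable_colourings :: "vertex set \<Rightarrow> nat \<Rightarrow> nat \<Rightarrow> colouring set" where
  "stable_colourings V k c =
     {\<phi> \<in> colourings V c. \<forall>e\<in>hyperedges V k. \<not> monochromatic \<phi> e}"

definition num_stable :: "vertex set \<Rightarrow> nat \<Rightarrow> nat \<Rightarrow> nat" where
  "num_stable V k c = card (stable_colourings V k c)"

definition lex_less :: "vertex \<Rightarrow> vertex \<Rightarrow> bool" where
  "lex_less u v \<longleftrightarrow> fst u < fst v \<or> fst u = fst v \<and> snd u < snd v"

text \<open>For finite \<open>V\<close> this is the list \<open>[v\<^sub>1, v\<^sub>2, \<dots>]\<close> of the vertices in increasing order.\<close>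

definition vertex_order :: "vertex set \<Rightarrow> vertex list" where
  "vertex_order V = (THE vs. sorted_wrt lex_less vs \<and> set vs = V)"

definition Y :: "vertex set \<Rightarrow> nat \<Rightarrow> nat \<Rightarrow> nat \<Rightarrow> colouring set" where
  "Y V k c t = {\<phi> \<in> colourings V c.
     \<forall>v \<in> set (take t (vertex_order V)). \<forall>e \<in> hyperedges V k. v \<in> e \<longrightarrow> \<not> monochromatic \<phi> e}"


section \<open>Instances and their encoding\<close>

type_synonym inst = "vertex list \<times> nat \<times> nat"

text \<open>The vertex set is given as an explicit list, in any order. The value \<open>k = 0\<close> is excluded
  because a grid has no \<open>0\<close>-element hyperedges of the prescribed form.\<close>

definition instances :: "inst set" where
  "instances = {(vs, k, c). distinct vs \<and> (\<exists>n m. grid_vertices n m (set vs)) \<and> 1 \<le> k \<and> 2 < c}"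

fun bits :: "nat \<Rightarrow> bool list" where
  "bits n = (if n < 2 then [n = 1] else bits (n div 2) @ [odd n])"

declare bits.simps [simp del]

definition bitlen :: "nat \<Rightarrow> nat" where
  "bitlen n = length (bits n)"

text \<open>Words over the three-letter alphabet \<open>bool option\<close>: binary digits, and \<open>None\<close> as a
  terminator of each number.\<close>

definition enc_nats :: "nat list \<Rightarrow> bool option list" where
  "enc_nats ns = concat (map (\<lambda>n. map Some (bits n) @ [None]) ns)"

definition enc_inst :: "inst \<Rightarrow> bool option list" where
  "enc_inst = (\<lambda>(vs, k, c). enc_nats (k # c # concat (map (\<lambda>(i, j). [i, j]) vs)))"

definition enc_query :: "inst \<Rightarrow> nat \<Rightarrow> bool option list" where
  "enc_query = (\<lambda>(vs, k, c) t. enc_nats (k # c # t # concat (map (\<lambda>(i, j). [i, j]) vs)))"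


section \<open>Computations with running time\<close>

text \<open>A deterministic computation is a result together with the number of steps taken; a
  randomised one is a distribution of such pairs. Every call of a randomised computation inside
  \<open>rbind\<close> is a fresh, independent draw.\<close>

type_synonym 'a timed = "'a \<times> nat"
type_synonym 'a rtimed = "('a \<times> nat) pmf"

definition tret :: "'a \<Rightarrow> 'a timed" where
  "tret x = (x, 1)"

definition tbind :: "'a timed \<Rightarrow> ('a \<Rightarrow> 'b timed) \<Rightarrow> 'b timed" (infixl "\<bind>\<^sub>t" 54) where
  "tbind m f = (fst (f (fst m)), snd m + snd (f (fst m)))"

definition rbind :: "'a rtimed \<Rightarrow> ('a \<Rightarrow> 'b rtimed) \<Rightarrow> 'b rtimed" (infixl "\<bind>\<^sub>r" 54) where
  "rbind m f = bind_pmf m (\<lambda>(x, s). map_pmf (\<lambda>(y, r). (y, s + r)) (f x))"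

definition det :: "'a timed \<Rightarrow> 'a rtimed" where
  "det m = return_pmf m"

text \<open>Costs count bit operations on numbers in binary (schoolbook multiplication).\<close>

definition eqT :: "nat \<Rightarrow> nat \<Rightarrow> bool timed" where
  "eqT a b = (a = b, bitlen a + bitlen b)"

definition leT :: "nat \<Rightarrow> nat \<Rightarrow> bool timed" where
  "leT a b = (a \<le> b, bitlen a + bitlen b)"

definition lessT :: "nat \<Rightarrow> nat \<Rightarrow> bool timed" where
  "lessT a b = (a < b, bitlen a + bitlen b)"

definition addT :: "nat \<Rightarrow> nat \<Rightarrow> nat timed" where
  "addT a b = (a + b, bitlen a + bitlen b)"

definition subT :: "nat \<Rightarrow> nat \<Rightarrow> nat timed" where
  "subT a b = (a - b, bitlen a + bitlen b)"

definition mulT :: "nat \<Rightarrow> nat \<Rightarrow> nat timed" where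
  "mulT a b = (a * b, bitlen a * bitlen b)"

definition copyT :: "vertex \<Rightarrow> vertex timed" where
  "copyT v = (v, bitlen (fst v) + bitlen (snd v))"


section \<open>Fully polynomial randomised approximation schemes\<close>

text \<open>
  \<open>D\<close> is the set of admissible inputs, written as words over a finite alphabet by \<open>enc\<close>.
  A bound by a polynomial in several nonnegative quantities is the same as a bound by a univariate
  polynomial in their sum.

  The accuracy parameter is a positive real. The running time is bounded for all of its values,
  the quality guarantee is the usual one for \<open>\<epsilon> \<le> 1\<close>: for very large \<open>\<epsilon>\<close> the sample size used
  below degenerates to a single sample, and the guarantee fails (for instance for \<open>k = 2\<close>,
  \<open>c = 3\<close>, a path of \<open>30\<close> vertices, \<open>\<epsilon> = 900\<close> and \<open>\<delta> = (2/3)^29 / 2\<close>).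
\<close>

definition fpras ::
  "'i set \<Rightarrow> ('i \<Rightarrow> 'a::finite list) \<Rightarrow> ('i \<Rightarrow> nat) \<Rightarrow> ('i \<Rightarrow> real \<Rightarrow> real \<Rightarrow> real rtimed) \<Rightarrow> bool" where
  "fpras D enc f A \<longleftrightarrow>
     (\<exists>p :: real poly. \<forall>x\<in>D. \<forall>\<epsilon> \<delta>. 0 < \<epsilon> \<and> 0 < \<delta> \<and> \<delta> < 1 \<longrightarrow>
        (\<forall>(y, \<tau>) \<in> set_pmf (A x \<epsilon> \<delta>).
           real \<tau> \<le> poly p (real (length (enc x)) + 1 / \<epsilon> + ln (1 / \<delta>)))) \<and>
     (\<forall>x\<in>D. \<forall>\<epsilon> \<delta>. 0 < \<epsilon> \<and> \<epsilon> \<le> 1 \<and> 0 < \<delta> \<and> \<delta> < 1 \<longrightarrow>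
        measure_pmf.prob (A x \<epsilon> \<delta>)
          {(y, \<tau>). (1 - \<epsilon>) * real (f x) \<le> y \<and> y \<le> (1 + \<epsilon>) * real (f x)} \<ge> 1 - \<delta>)"


section \<open>Samplers\<close>

type_synonym sampler = "inst \<Rightarrow> nat \<Rightarrow> colouring rtimed"

text \<open>For \<open>k = 1\<close> the set \<open>Y V k c t\<close> may be empty, and there is nothing to draw from; all that is
  then asked of the procedure is that it stops in time, with some colouring.\<close>

definition poly_time_uniform_sampler :: "sampler \<Rightarrow> bool" where
  "poly_time_uniform_sampler S \<longleftrightarrow>
     (\<forall>(vs, k, c) \<in> instances. \<forall>t \<le> length vs.
        set_pmf (map_pmf fst (S (vs, k, c) t)) \<subseteq> colourings (set vs) c \<and>
        (Y (set vs) k c t \<noteq> {} \<longrightarrow>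
           map_pmf fst (S (vs, k, c) t) = pmf_of_set (Y (set vs) k c t))) \<and>
     (\<exists>p :: real poly. \<forall>(vs, k, c) \<in> instances. \<forall>t \<le> length vs.
        \<forall>(\<phi>, \<tau>) \<in> set_pmf (S (vs, k, c) t).
          real \<tau> \<le> poly p (real (length (enc_query (vs, k, c) t))))"


section \<open>Testing membership in the sets \<open>Y\<close>\<close>

text \<open>A colouring is stored as the table of the colours of the listed vertices, which is searched
  sequentially; \<open>None\<close> means that \<open>v\<close> is not a vertex.\<close>

primrec lookupT :: "colouring \<Rightarrow> vertex list \<Rightarrow> vertex \<Rightarrow> nat option timed" where
  "lookupT \<phi> [] v = tret None"
| "lookupT \<phi> (w # ws) v =
     eqT (fst w) (fst v) \<bind>\<^sub>t (\<lambda>p.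
     eqT (snd w) (snd v) \<bind>\<^sub>t (\<lambda>q.
     if p \<and> q then (Some (\<phi> w), bitlen (\<phi> w)) else lookupT \<phi> ws v))"

text \<open>The flag \<open>d\<close> selects the direction of a hyperedge: \<open>True\<close> if the first coordinate grows,
  \<open>False\<close> if the second one does. A hyperedge is given by its least vertex and its direction.\<close>

definition stepT :: "bool \<Rightarrow> vertex \<Rightarrow> vertex timed" where
  "stepT d v = (if d then addT (fst v) 1 \<bind>\<^sub>t (\<lambda>i. tret (i, snd v))
                else addT (snd v) 1 \<bind>\<^sub>t (\<lambda>j. tret (fst v, j)))"

text \<open>Are the \<open>r\<close> consecutive positions from \<open>v\<close> on all vertices of colour \<open>a\<close>? The walk stops at
  the first failure, so it takes at most \<open>|V| + 1\<close> rounds however large \<open>r\<close> is.\<close>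

primrec walkT :: "colouring \<Rightarrow> vertex list \<Rightarrow> bool \<Rightarrow> nat \<Rightarrow> nat \<Rightarrow> vertex \<Rightarrow> bool timed" where
  "walkT \<phi> vs d a 0 v = tret True"
| "walkT \<phi> vs d a (Suc r) v =
     subT (Suc r) 1 \<bind>\<^sub>t (\<lambda>_.
     lookupT \<phi> vs v \<bind>\<^sub>t (\<lambda>x. case x of
       None \<Rightarrow> tret False
     | Some b \<Rightarrow> eqT a b \<bind>\<^sub>t (\<lambda>p.
         if p then stepT d v \<bind>\<^sub>t walkT \<phi> vs d a r else tret False)))"

definition mono_edgeT :: "colouring \<Rightarrow> vertex list \<Rightarrow> nat \<Rightarrow> bool \<Rightarrow> vertex \<Rightarrow> bool timed" where
  "mono_edgeT \<phi> vs k d u =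
     lookupT \<phi> vs u \<bind>\<^sub>t (\<lambda>x. case x of
       None \<Rightarrow> tret False
     | Some a \<Rightarrow> walkT \<phi> vs d a k u)"

definition segmentT :: "nat \<Rightarrow> nat \<times> nat \<Rightarrow> nat \<times> nat \<Rightarrow> bool timed" where
  "segmentT k = (\<lambda>(x, a) (x', a').
     eqT x x' \<bind>\<^sub>t (\<lambda>p.
     leT a a' \<bind>\<^sub>t (\<lambda>q.
     addT a k \<bind>\<^sub>t (\<lambda>s.
     lessT a' s \<bind>\<^sub>t (\<lambda>r. tret (p \<and> q \<and> r))))))"

definition on_edgeT :: "nat \<Rightarrow> bool \<Rightarrow> vertex \<Rightarrow> vertex \<Rightarrow> bool timed" where
  "on_edgeT k d u v =
     (if d then segmentT k (snd u, fst u) (snd v, fst v) else segmentT k u v)"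

definition mono_edge_atT ::
  "colouring \<Rightarrow> vertex list \<Rightarrow> nat \<Rightarrow> vertex \<Rightarrow> bool \<Rightarrow> vertex \<Rightarrow> bool timed" where
  "mono_edge_atT \<phi> vs k v d u =
     on_edgeT k d u v \<bind>\<^sub>t (\<lambda>p. if p then mono_edgeT \<phi> vs k d u else tret False)"

text \<open>Does \<open>v\<close> lie on a monochromatic hyperedge starting in one of the vertices of the last
  argument?\<close>

primrec badT :: "colouring \<Rightarrow> vertex list \<Rightarrow> nat \<Rightarrow> vertex \<Rightarrow> vertex list \<Rightarrow> bool timed" where
  "badT \<phi> vs k v [] = tret False"
| "badT \<phi> vs k v (u # us) =
     mono_edge_atT \<phi> vs k v False u \<bind>\<^sub>t (\<lambda>p. if p then tret True else
     mono_edge_atT \<phi> vs k v True u \<bind>\<^sub>t (\<lambda>q. if q then tret True else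
     badT \<phi> vs k v us))"

text \<open>With \<open>v\<^sub>1, \<dots>, v\<^sub>t\<close> as the last argument, this decides whether the colouring is in \<open>Y\<^sub>t\<close>.\<close>

primrec in_YT :: "colouring \<Rightarrow> vertex list \<Rightarrow> nat \<Rightarrow> vertex list \<Rightarrow> bool timed" where
  "in_YT \<phi> vs k [] = tret True"
| "in_YT \<phi> vs k (v # pre) =
     badT \<phi> vs k v vs \<bind>\<^sub>t (\<lambda>p. if p then tret False else in_YT \<phi> vs k pre)"


section \<open>Multilevel splitting\<close>

definition lexT :: "vertex \<Rightarrow> vertex \<Rightarrow> bool timed" where
  "lexT u v =
     lessT (fst u) (fst v) \<bind>\<^sub>t (\<lambda>p. if p then tret True else
     eqT (fst u) (fst v) \<bind>\<^sub>t (\<lambda>q. if q then lessT (snd u) (snd v) else tret False))"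

primrec insertT :: "vertex \<Rightarrow> vertex list \<Rightarrow> vertex list timed" where
  "insertT v [] = tret [v]"
| "insertT v (w # ws) =
     lexT v w \<bind>\<^sub>t (\<lambda>p. if p then tret (v # w # ws)
       else insertT v ws \<bind>\<^sub>t (\<lambda>xs. tret (w # xs)))"

primrec sortT :: "vertex list \<Rightarrow> vertex list timed" where
  "sortT [] = tret []"
| "sortT (v # vs) = sortT vs \<bind>\<^sub>t insertT v"

primrec lengthT :: "vertex list \<Rightarrow> nat timed" where
  "lengthT [] = tret 0"
| "lengthT (v # vs) = lengthT vs \<bind>\<^sub>t (\<lambda>n. addT n 1)"

primrec takeT :: "nat \<Rightarrow> vertex list \<Rightarrow> vertex list timed" where
  "takeT t [] = tret []"
| "takeT t (v # vs) =
     eqT t 0 \<bind>\<^sub>t (\<lambda>p. if p then tret [] else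
     subT t 1 \<bind>\<^sub>t (\<lambda>t'.
     takeT t' vs \<bind>\<^sub>t (\<lambda>xs.
     copyT v \<bind>\<^sub>t (\<lambda>v'. tret (v' # xs)))))"

primrec mul_powT :: "nat \<Rightarrow> nat \<Rightarrow> nat \<Rightarrow> nat timed" where
  "mul_powT a c 0 = tret a"
| "mul_powT a c (Suc r) =
     subT (Suc r) 1 \<bind>\<^sub>t (\<lambda>_. mulT a c \<bind>\<^sub>t (\<lambda>a'. mul_powT a' c r))"

text \<open>As \<open>\<epsilon>\<close> and \<open>\<delta>\<close> are arbitrary reals, the sample size is the one quantity computed with real
  arithmetic. It is charged one step for each of its nine operations, plus the length of the
  result.\<close>

definition T_sample :: "nat \<Rightarrow> real \<Rightarrow> real \<Rightarrow> nat" where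
  "T_sample n \<epsilon> \<delta> = nat \<lceil>54 * (real n / \<epsilon>)\<^sup>2 * ln (2 * real n / \<delta>)\<rceil>"

definition T_sampleT :: "nat \<Rightarrow> real \<Rightarrow> real \<Rightarrow> nat timed" where
  "T_sampleT n \<epsilon> \<delta> = (T_sample n \<epsilon> \<delta>, 9 + bitlen (T_sample n \<epsilon> \<delta>))"

text \<open>Draws \<open>r\<close> samples from \<open>Y\<^sub>t\<^sub>-\<^sub>1\<close> and adds the number of those lying in \<open>Y\<^sub>t\<close> to \<open>cnt\<close>.
  Here \<open>pre\<close> is \<open>[v\<^sub>1, \<dots>, v\<^sub>t]\<close>.\<close>

primrec countT ::
  "sampler \<Rightarrow> inst \<Rightarrow> nat \<Rightarrow> vertex list \<Rightarrow> nat \<Rightarrow> nat \<Rightarrow> nat rtimed" where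
  "countT S x t pre 0 cnt = det (tret cnt)"
| "countT S x t pre (Suc r) cnt =
     det (subT (Suc r) 1) \<bind>\<^sub>r (\<lambda>_.
     det (subT t 1) \<bind>\<^sub>r (\<lambda>s.
     S x s \<bind>\<^sub>r (\<lambda>\<phi>.
     det (case x of (vs, k, c) \<Rightarrow> in_YT \<phi> vs k pre) \<bind>\<^sub>r (\<lambda>b.
     det (if b then addT cnt 1 else tret cnt) \<bind>\<^sub>r (\<lambda>cnt'.
     countT S x t pre r cnt')))))"

text \<open>The levels \<open>t, t + 1, \<dots>\<close>, \<open>r\<close> of them; the product of the ratios \<open>count\<^sub>t / T\<^sub>s\<^sub>a\<^sub>m\<^sub>p\<^sub>l\<^sub>e\<close> is
  accumulated exactly, as the fraction \<open>a / b\<close>. The list \<open>ws\<close> is \<open>[v\<^sub>1, v\<^sub>2, \<dots>]\<close>.\<close>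

primrec levelsT ::
  "sampler \<Rightarrow> inst \<Rightarrow> vertex list \<Rightarrow> nat \<Rightarrow> nat \<Rightarrow> nat \<Rightarrow> nat \<Rightarrow> nat \<Rightarrow> (nat \<times> nat) rtimed" where
  "levelsT S x ws T 0 t a b = det (tret (a, b))"
| "levelsT S x ws T (Suc r) t a b =
     det (subT (Suc r) 1) \<bind>\<^sub>r (\<lambda>_.
     det (takeT t ws) \<bind>\<^sub>r (\<lambda>pre.
     countT S x t pre T 0 \<bind>\<^sub>r (\<lambda>cnt.
     det (mulT a cnt) \<bind>\<^sub>r (\<lambda>a'.
     det (mulT b T) \<bind>\<^sub>r (\<lambda>b'.
     det (addT t 1) \<bind>\<^sub>r (\<lambda>t'.
     levelsT S x ws T r t' a' b'))))))"

definition multilevel_splitting ::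
  "sampler \<Rightarrow> inst \<Rightarrow> real \<Rightarrow> real \<Rightarrow> (nat \<times> nat) rtimed" where
  "multilevel_splitting S x \<epsilon> \<delta> =
     (case x of (vs, k, c) \<Rightarrow>
       det (lengthT vs) \<bind>\<^sub>r (\<lambda>n.
       det (T_sampleT n \<epsilon> \<delta>) \<bind>\<^sub>r (\<lambda>T.
       det (sortT vs) \<bind>\<^sub>r (\<lambda>ws.
       levelsT S x ws T n 1 1 1))))"

text \<open>The estimate of the number of stable colourings, output as a fraction.\<close>

definition splitting_estimate ::
  "sampler \<Rightarrow> inst \<Rightarrow> real \<Rightarrow> real \<Rightarrow> real rtimed" where
  "splitting_estimate S x \<epsilon> \<delta> =
     (case x of (vs, k, c) \<Rightarrow>
       multilevel_splitting S x \<epsilon> \<delta> \<bind>\<^sub>r (\<lambda>(a, b).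
       det (lengthT vs) \<bind>\<^sub>r (\<lambda>n.
       det (mul_powT a c n) \<bind>\<^sub>r (\<lambda>a'.
       det (real a' / real b, bitlen a' + bitlen b)))))"

end

theory Submission
  imports Defs "HOL-Probability.Hoeffding"
begin

text \<open>Put \<open>y\<^sub>t = |Y\<^sub>t|\<close> and \<open>n = |V|\<close>. Then \<open>y\<^sub>0 = c\<^sup>n\<close>, \<open>y\<^sub>n = P(H,c)\<close>, and \<open>P(H,c) / c\<^sup>n\<close> is the
  telescoping product of the ratios \<open>p\<^sub>t = y\<^sub>t / y\<^sub>t\<^sub>-\<^sub>1\<close>. The algorithm estimates each ratio by sampling,
  so everything depends on no ratio being small.

  For \<open>k \<ge> 2\<close> and \<open>c \<ge> 3\<close> one has \<open>p\<^sub>t \<ge> 1/4\<close> (\<open>card_Y_le\<close>). A colouring in \<open>Y\<^sub>t\<^sub>-\<^sub>1\<close> can fail to be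
  in \<open>Y\<^sub>t\<close> only through the horizontal or the vertical hyperedge that starts in \<open>v\<^sub>t\<close>, because any other
  monochromatic hyperedge through \<open>v\<^sub>t\<close> would contain an earlier vertex. Recolouring \<open>v\<^sub>t\<close> itself does not
  work in general: with three colours every choice may be blocked. Recolouring the far ends of the
  monochromatic ones among these two hyperedges does work, since only two colours have to be avoided
  to keep the earlier vertices safe. The original colouring can be recovered from the new one once it is
  known which of the two ends were changed, whence the factor \<open>4\<close>.

  With \<open>p\<^sub>t \<ge> 1/4\<close>, Hoeffding's inequality shows that the prescribed sample size yields relative error at
  most \<open>\<epsilon> / (2n)\<close> at one level except with probability \<open>\<delta> / n\<close> (\<open>binomial_relative_error\<close>). A union bound
  over the levels (\<open>levels_accurate\<close>) and, for \<open>\<epsilon> \<le> 1\<close>, the inequalities \<open>1 - \<epsilon> \<le> (1 - \<epsilon>/2n)\<^sup>n\<close> and \<open>(1 + \<epsilon>/2n)\<^sup>n \<le> 1 + \<epsilon>\<close> give the guarantee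
  (\<open>estimate_accurate\<close>). Two degenerate cases are exact: without vertices the answer is \<open>1\<close>, and for \<open>k = 1\<close>
  with \<open>V\<close> nonempty it is \<open>0\<close>, which the first level already detects.

  For the running time, let \<open>L\<close> be the length of the encoded input. All numbers that occur in the membership
  tests are at most \<open>2\<^sup>L\<^sup>+\<^sup>1\<close>, hence have at most \<open>L + 2\<close> binary digits, and the number of rounds of each
  loop is bounded by \<open>n\<close> or by the sample size. The one loop that is nominally controlled by the possibly huge
  number \<open>k\<close> is the walk along a hyperedge; it stops when it leaves \<open>V\<close>, so it has at most \<open>n + 1\<close> rounds
  (\<open>walk_time\<close>). The sample size is polynomial in \<open>n\<close>, \<open>1/\<epsilon>\<close> and \<open>ln (1/\<delta>)\<close> (\<open>T_sample_le\<close>).\<close>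

section \<open>The proportion of surviving colourings at one level\<close>

lemma colourings_finite: "finite V \<Longrightarrow> finite (colourings V c)"
  unfolding colourings_def by (rule finite_PiE) auto

lemma card_colourings: "finite V \<Longrightarrow> card (colourings V c) = c ^ card V"
  unfolding colourings_def by (simp add: card_PiE)

text \<open>The sets \<open>Y\<^sub>t\<close> with the initial segment of the vertex order replaced by an arbitrary set \<open>X\<close>; this lets
  the comparison of two consecutive levels be stated without reference to the ordered vertex list.\<close>

definition avoiding :: "vertex set \<Rightarrow> nat \<Rightarrow> nat \<Rightarrow> vertex set \<Rightarrow> colouring set" where
  "avoiding V k c X = {\<phi> \<in> colourings V c.
     \<forall>x\<in>X. \<forall>e\<in>hyperedges V k. x \<in> e \<longrightarrow> \<not> monochromatic \<phi> e}"

text \<open>The positions of a would-be hyperedge with given least vertex, in the direction selected by the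
  flag \<open>d\<close>: \<open>True\<close> makes the first coordinate grow (vertical), \<open>False\<close> the second one (horizontal).\<close>

definition segment :: "nat \<Rightarrow> bool \<Rightarrow> vertex \<Rightarrow> vertex set" where
  "segment k d v = (if d then {(fst v + l, snd v) | l. l < k} else {(fst v, snd v + l) | l. l < k})"

lemma hyperedges_segment: "hyperedges V k = {e. e \<subseteq> V \<and> (\<exists>d u. e = segment k d u)}"
proof -
  have "(\<exists>i j. e = {(i, j + l) | l. l < k} \<or> e = {(i + l, j) | l. l < k}) \<longleftrightarrow>
        (\<exists>d u. e = segment k d u)" for e :: "vertex set"
  proof -
    have "(\<exists>d u. e = segment k d u) \<longleftrightarrow>
        (\<exists>u. e = segment k False u) \<or> (\<exists>u. e = segment k True u)"
      by (rule ex_bool_eq[THEN trans]) (rule disj_commute)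
    also have "\<dots> \<longleftrightarrow> (\<exists>i j. e = {(i, j + l) | l. l < k}) \<or> (\<exists>i j. e = {(i + l, j) | l. l < k})"
      unfolding segment_def split_paired_Ex if_True if_False fst_conv snd_conv ..
    finally show ?thesis by (simp only: ex_disj_distrib)
  qed
  then show ?thesis unfolding hyperedges_def by (simp only:)
qed

lemma mem_segment:
  "w \<in> segment k True u \<longleftrightarrow> snd w = snd u \<and> fst u \<le> fst w \<and> fst w < fst u + k"
  "w \<in> segment k False u \<longleftrightarrow> fst w = fst u \<and> snd u \<le> snd w \<and> snd w < snd u + k"
proof -
  have shift: "(\<exists>l. x = a + l \<and> l < k) \<longleftrightarrow> a \<le> x \<and> x < a + k" for x a :: nat
    by (metis add_less_cancel_left le_iff_add)
  show "w \<in> segment k True u \<longleftrightarrow> snd w = snd u \<and> fst u \<le> fst w \<and> fst w < fst u + k"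
    "w \<in> segment k False u \<longleftrightarrow> fst w = fst u \<and> snd u \<le> snd w \<and> snd w < snd u + k"
    unfolding segment_def mem_Collect_eq prod_eq_iff fst_conv snd_conv if_True if_False shift[symmetric]
    by blast+
qed

lemma start_mem_segment: "0 < k \<Longrightarrow> u \<in> segment k d u"
  by (cases d) (auto simp: mem_segment)

lemma segment_mem_hyperedges: "segment k d u \<in> hyperedges V k \<longleftrightarrow> segment k d u \<subseteq> V"
  unfolding hyperedges_segment by blast

definition segment_end :: "nat \<Rightarrow> bool \<Rightarrow> vertex \<Rightarrow> vertex" where
  "segment_end k d v = (if d then (fst v + (k - 1), snd v) else (fst v, snd v + (k - 1)))"

lemma segment_end_mem: "0 < k \<Longrightarrow> segment_end k d v \<in> segment k d v"
  by (cases d) (auto simp: mem_segment segment_end_def)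

text \<open>The geometric reason why recolouring the far end of a segment that starts in \<open>v\<close> is harmless: a segment
  through this far end that also contains a vertex not after \<open>v\<close> is either the segment that starts in \<open>v\<close> itself,
  or, for the horizontal direction only, a vertical one, which then also passes through the position
  with the preceding first coordinate. So a single neighbour has to be watched.\<close>

lemma segment_reaching_back:
  assumes k: "2 \<le> k" and w: "w \<in> segment k d' s" and wv: "w = v \<or> lex_less w v"
    and x: "segment_end k d v \<in> segment k d' s"
  shows "segment k d' s = segment k d v \<or>
    (\<not> d \<and> (fst v - 1, snd v + (k - 1)) \<in> segment k d' s \<and> 0 < fst v)"
proof (cases d; cases d')
  assume "d" "d'"
  moreover from this have "s = v"
    using assms by (cases s; cases v; cases w) (auto simp: mem_segment segment_end_def lex_less_def)
  ultimately show ?thesis by simp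
next
  assume "\<not> d" "\<not> d'"
  moreover from this have "s = v"
    using assms by (cases s; cases v; cases w) (auto simp: mem_segment segment_end_def lex_less_def)
  ultimately show ?thesis by simp
next
  assume "d" "\<not> d'"
  then show ?thesis
    using assms by (cases s; cases v; cases w) (auto simp: mem_segment segment_end_def lex_less_def)
next
  assume "\<not> d" "d'"
  then show ?thesis
    using assms by (cases s; cases v; cases w) (auto simp: mem_segment segment_end_def lex_less_def)
qed

lemma segment_least:
  assumes "v \<in> segment k d s"
  shows "s = v \<or> lex_less s v"
  using assms by (cases d; cases s; cases v) (auto simp: mem_segment lex_less_def)

lemma monochromatic_cong: "(\<And>x. x \<in> e \<Longrightarrow> \<phi> x = \<psi> x) \<Longrightarrow> monochromatic \<phi> e = monochromatic \<psi> e"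
  unfolding monochromatic_def by simp

text \<open>Each colouring \<open>\<phi>\<close> is sent to the set \<open>D \<phi>\<close> of the directions in which a monochromatic hyperedge starts
  in \<open>v\<close>, together with the colouring \<open>F \<phi>\<close> in which the far ends \<open>W \<phi>\<close> of these hyperedges have a new colour.
  The new colour avoids that of \<open>v\<close>, which destroys the hyperedges in question, and that of the position \<open>z\<close>
  that precedes the horizontal far end vertically, which by \<open>segment_reaching_back\<close> prevents new monochromatic hyperedges
  through \<open>v\<close> or a lower vertex. Three colours suffice for this. The map is injective, as the far ends originally
  had the colour of \<open>v\<close>, and there are four possible sets of directions.\<close>

lemma card_avoiding_below_le:
  assumes V: "finite V" and v: "v \<in> V" and k: "2 \<le> k" and c: "2 < c"
  defines "X \<equiv> {w \<in> V. lex_less w v}"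
  shows "card (avoiding V k c X) \<le> 4 * card (avoiding V k c (insert v X))"
proof -
  let ?A = "avoiding V k c X" and ?B = "avoiding V k c (insert v X)"
  define z where "z = (fst v - 1, snd v + (k - 1))"
  define D where "D \<phi> = {d. segment k d v \<in> hyperedges V k \<and> monochromatic \<phi> (segment k d v)}" for \<phi>
  define W where "W \<phi> = (\<lambda>d. segment_end k d v) ` D \<phi>" for \<phi>
  define g where "g \<phi> = (SOME a. a \<in> {1..c} - {\<phi> v, \<phi> z})" for \<phi> :: colouring
  define F where "F \<phi> = (\<lambda>x. if x \<in> W \<phi> then g \<phi> else \<phi> x)" for \<phi>
  have g: "g \<phi> \<in> {1..c} - {\<phi> v, \<phi> z}" for \<phi>
  proof -
    have "card ({1..c} - {\<phi> v, \<phi> z}) \<ge> card {1..c} - card {\<phi> v, \<phi> z}"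
      by (intro diff_card_le_card_Diff) auto
    moreover have "card {\<phi> v, \<phi> z} \<le> 2" by (simp add: card_insert_if)
    ultimately have "0 < card ({1..c} - {\<phi> v, \<phi> z})" using c by simp
    then have "{1..c} - {\<phi> v, \<phi> z} \<noteq> {}" by (metis card.empty less_irrefl)
    then show ?thesis unfolding g_def by (rule some_in_eq[THEN iffD2])
  qed
  \<comment> \<open>For \<open>k \<ge> 2\<close> the far ends differ from \<open>v\<close>, whose colour is thus preserved.\<close>
  have vW: "v \<notin> W \<phi>" for \<phi>
    using k by (cases v) (auto simp: W_def segment_end_def split: if_splits)
  have zW: "z \<notin> W \<phi>" if "0 < fst v" for \<phi>
    using k that by (cases v) (auto simp: W_def z_def segment_end_def split: if_splits)
  have Fv: "F \<phi> v = \<phi> v" for \<phi> using vW by (simp add: F_def)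
  have W_mono: "\<phi> x = \<phi> v" if "x \<in> W \<phi>" for \<phi> x
  proof -
    from that obtain d where d: "d \<in> D \<phi>" and x: "x = segment_end k d v" unfolding W_def by blast
    have "segment_end k d v \<in> segment k d v" "v \<in> segment k d v"
      using k by (simp_all add: segment_end_mem start_mem_segment)
    then show ?thesis using d unfolding x D_def monochromatic_def by blast
  qed
  have W_V: "W \<phi> \<subseteq> V" for \<phi>
  proof
    fix x assume "x \<in> W \<phi>"
    then obtain d where d: "d \<in> D \<phi>" and x: "x = segment_end k d v" unfolding W_def by blast
    have "segment_end k d v \<in> segment k d v" using k by (simp add: segment_end_mem)
    then show "x \<in> V" using d unfolding x D_def segment_mem_hyperedges by blast
  qed
  have FB: "F \<phi> \<in> ?B" if A: "\<phi> \<in> ?A" for \<phi>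
  proof -
    have col: "\<phi> \<in> V \<rightarrow>\<^sub>E {1..c}" using A by (simp add: avoiding_def colourings_def)
    have "F \<phi> \<in> V \<rightarrow>\<^sub>E {1..c}"
      using col W_V[of \<phi>] g[of \<phi>] by (auto simp: F_def PiE_iff extensional_def)
    moreover have False
      if e: "e \<in> hyperedges V k" and w: "w \<in> e" "w = v \<or> w \<in> X" and m: "monochromatic (F \<phi>) e" for w e
    proof -
      obtain d' s where ds: "e = segment k d' s" using e by (auto simp: hyperedges_segment)
      have w': "w = v \<or> lex_less w v" using w by (auto simp: X_def)
      show False
      proof (cases "e \<inter> W \<phi> = {}")
        case True
        then have m': "monochromatic \<phi> e"
          using m monochromatic_cong[of e "F \<phi>" \<phi>] by (metis F_def IntI empty_iff)
        then have "w \<notin> X" using A e w(1) by (auto simp: avoiding_def)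
        then have "v \<in> e" using w by auto
        have "s \<in> e" using start_mem_segment[of k s d'] k ds by auto
        then have "s \<notin> X" using A e m' by (auto simp: avoiding_def)
        moreover have "s \<in> V" using \<open>s \<in> e\<close> e by (auto simp: hyperedges_def)
        ultimately have "s = v" using segment_least[of v k d' s] \<open>v \<in> e\<close> ds by (auto simp: X_def)
        \<comment> \<open>\<open>e\<close> starts in \<open>v\<close> and was monochromatic before, so its far end has been recoloured.\<close>
        then have "d' \<in> D \<phi>" using m' e ds by (simp add: D_def)
        then have "segment_end k d' v \<in> W \<phi>" by (auto simp: W_def)
        moreover have "segment_end k d' v \<in> e" using segment_end_mem[of k d' v] k ds \<open>s = v\<close> by auto
        ultimately show False using True by blast
      next
        case False
        then obtain x where x: "x \<in> e" "x \<in> W \<phi>" by blast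
        then obtain d where d: "x = segment_end k d v" by (auto simp: W_def)
        have Fx: "F \<phi> x = g \<phi>" using x by (simp add: F_def)
        have "e = segment k d v \<or> z \<in> e \<and> 0 < fst v"
          using segment_reaching_back[OF k _ w', of d' s d] w(1) x(1) unfolding d ds z_def by blast
        then consider "v \<in> e" | "z \<in> e" "0 < fst v"
          using start_mem_segment[of k v d] k by fastforce
        then show False
        proof cases
          case 1
          then have "F \<phi> x = F \<phi> v" using m x unfolding monochromatic_def by blast
          then show False using g[of \<phi>] Fx Fv by auto
        next
          case 2
          then have "F \<phi> x = F \<phi> z" using m x unfolding monochromatic_def by blast
          moreover have "F \<phi> z = \<phi> z" using zW 2 by (simp add: F_def)
          ultimately show False using g[of \<phi>] Fx by auto
        qed
      qed
    qed
    ultimately show ?thesis unfolding avoiding_def colourings_def by blast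
  qed
  have "inj_on (\<lambda>\<phi>. (D \<phi>, F \<phi>)) ?A"
  proof (rule inj_onI)
    fix \<phi> \<psi> assume "(D \<phi>, F \<phi>) = (D \<psi>, F \<psi>)"
    then have W: "W \<phi> = W \<psi>" and F: "F \<phi> = F \<psi>" by (simp_all add: W_def)
    show "\<phi> = \<psi>"
    proof
      fix x
      show "\<phi> x = \<psi> x"
      proof (cases "x \<in> W \<phi>")
        case True
        have "\<phi> x = F \<phi> v" using W_mono[OF True] Fv by simp
        also have "\<dots> = \<psi> x" using W_mono[of x \<psi>] True W F Fv by simp
        finally show ?thesis .
      next
        case False
        then have "\<phi> x = F \<phi> x" by (simp add: F_def)
        also have "\<dots> = \<psi> x" using False W F by (simp add: F_def)
        finally show ?thesis .
      qed
    qed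
  qed
  moreover have "(\<lambda>\<phi>. (D \<phi>, F \<phi>)) ` ?A \<subseteq> UNIV \<times> ?B" using FB by auto
  moreover have "finite ?B" using colourings_finite[OF V] by (simp add: avoiding_def)
  ultimately have "card ?A \<le> card ((UNIV :: bool set set) \<times> ?B)"
    by (intro card_inj_on_le) (auto intro: finite_cartesian_product)
  also have "\<dots> = 4 * card ?B"
    by (simp add: card_cartesian_product card_UNIV_bool Pow_UNIV[symmetric] card_Pow del: Pow_UNIV)
  finally show ?thesis .
qed

section \<open>Correctness of the deterministic subroutines\<close>

lemma linorder_lex_less: "class.linorder (\<lambda>u v. lex_less u v \<or> u = v) lex_less"
  by unfold_locales (auto simp: lex_less_def prod_eq_iff)

lemma vertex_order_eqI:
  assumes "sorted_wrt lex_less ws" "set ws = V"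
  shows "vertex_order V = ws"
  unfolding vertex_order_def
  by (rule the_equality) (use assms linorder.strict_sorted_equal[OF linorder_lex_less] in auto)

lemma lex_less_trans: "lex_less u v \<Longrightarrow> lex_less v w \<Longrightarrow> lex_less u w"
  by (auto simp: lex_less_def)

lemma lex_less_asym: "lex_less u v \<Longrightarrow> \<not> lex_less v u"
  by (auto simp: lex_less_def)

lemma lex_less_total: "u \<noteq> v \<Longrightarrow> \<not> lex_less u v \<Longrightarrow> lex_less v u"
  by (auto simp: lex_less_def prod_eq_iff)

lemma fst_tret [simp]: "fst (tret x) = x" by (simp add: tret_def)

lemma fst_tbind [simp]: "fst (m \<bind>\<^sub>t f) = fst (f (fst m))" by (simp add: tbind_def)

lemma fst_primitives [simp]:
  "fst (eqT a b) = (a = b)" "fst (leT a b) = (a \<le> b)" "fst (lessT a b) = (a < b)"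
  "fst (addT a b) = a + b" "fst (subT a b) = a - b" "fst (mulT a b) = a * b" "fst (copyT v) = v"
  "fst (T_sampleT n \<epsilon> \<delta>) = T_sample n \<epsilon> \<delta>"
  by (simp_all add: eqT_def leT_def lessT_def addT_def subT_def mulT_def copyT_def T_sampleT_def)

lemma fst_lengthT [simp]: "fst (lengthT vs) = length vs"
  by (induction vs) simp_all

lemma fst_takeT [simp]: "fst (takeT t vs) = take t vs"
  by (induction vs arbitrary: t) (simp_all add: take_Cons')

lemma fst_mul_powT [simp]: "fst (mul_powT a c r) = a * c ^ r"
  by (induction r arbitrary: a) simp_all

lemma fst_lexT [simp]: "fst (lexT u v) = lex_less u v"
  by (auto simp: lexT_def lex_less_def)

lemma set_insertT: "set (fst (insertT v ws)) = insert v (set ws)"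
  by (induction ws) auto

lemma sorted_insertT:
  "sorted_wrt lex_less ws \<Longrightarrow> v \<notin> set ws \<Longrightarrow> sorted_wrt lex_less (fst (insertT v ws))"
  by (induction ws) (auto simp: set_insertT dest: lex_less_total intro: lex_less_trans)

lemma set_sortT: "set (fst (sortT vs)) = set vs"
  by (induction vs) (auto simp: set_insertT)

lemma length_insertT: "length (fst (insertT v ws)) = Suc (length ws)"
  by (induction ws) auto

lemma length_sortT: "length (fst (sortT vs)) = length vs"
  by (induction vs) (auto simp: length_insertT)

lemma sorted_sortT: "distinct vs \<Longrightarrow> sorted_wrt lex_less (fst (sortT vs))"
  by (induction vs) (auto simp: set_sortT intro: sorted_insertT)

lemma fst_sortT: "distinct vs \<Longrightarrow> fst (sortT vs) = vertex_order (set vs)"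
  by (metis vertex_order_eqI sorted_sortT set_sortT)

lemma vertex_order:
  assumes "distinct vs"
  shows "sorted_wrt lex_less (vertex_order (set vs))" "set (vertex_order (set vs)) = set vs"
    "length (vertex_order (set vs)) = length vs"
  using assms by (metis fst_sortT sorted_sortT, metis fst_sortT set_sortT, metis fst_sortT length_sortT)

lemma fst_lookupT: "fst (lookupT \<phi> vs v) = (if v \<in> set vs then Some (\<phi> v) else None)"
  by (induction vs) (auto simp: prod_eq_iff)

definition shift :: "bool \<Rightarrow> vertex \<Rightarrow> nat \<Rightarrow> vertex" where
  "shift d v l = (if d then (fst v + l, snd v) else (fst v, snd v + l))"

lemma fst_stepT [simp]: "fst (stepT d v) = shift d v 1"
  by (simp add: stepT_def shift_def)

lemma segment_shift: "segment k d v = shift d v ` {..<k}"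
  by (auto simp: segment_def shift_def)

lemma fst_walkT:
  "fst (walkT \<phi> vs d a r v) \<longleftrightarrow> (\<forall>x \<in> segment r d v. x \<in> set vs \<and> \<phi> x = a)"
proof (induction r arbitrary: v a)
  case 0
  then show ?case by (simp add: segment_shift)
next
  case (Suc r)
  have "shift d v ` {..<Suc r} = insert v (shift d (shift d v 1) ` {..<r})"
    by (auto simp: lessThan_Suc_eq_insert_0 image_image shift_def)
  then show ?case
    by (auto simp: fst_lookupT Suc.IH segment_shift)
qed

lemma fst_mono_edgeT:
  assumes "0 < k"
  shows "fst (mono_edgeT \<phi> vs k d u) \<longleftrightarrow>
    segment k d u \<in> hyperedges (set vs) k \<and> monochromatic \<phi> (segment k d u)"
proof -
  have "fst (mono_edgeT \<phi> vs k d u) \<longleftrightarrow>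
      u \<in> set vs \<and> (\<forall>x\<in>segment k d u. x \<in> set vs \<and> \<phi> x = \<phi> u)"
    by (simp add: mono_edgeT_def fst_lookupT fst_walkT)
  then show ?thesis
    using start_mem_segment[OF assms, of u d]
    unfolding segment_mem_hyperedges monochromatic_def by (metis subset_iff)
qed

lemma fst_on_edgeT: "fst (on_edgeT k d u v) \<longleftrightarrow> v \<in> segment k d u"
  by (cases d; cases u; cases v) (auto simp: on_edgeT_def segmentT_def mem_segment)

lemma fst_badT:
  assumes "0 < k"
  shows "fst (badT \<phi> vs k v us) \<longleftrightarrow> (\<exists>u\<in>set us. \<exists>d. v \<in> segment k d u \<and>
    segment k d u \<in> hyperedges (set vs) k \<and> monochromatic \<phi> (segment k d u))"
  by (induction us)
    (simp_all add: mono_edge_atT_def fst_mono_edgeT[OF assms] fst_on_edgeT ex_bool_eq, blast)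

lemma fst_in_YT:
  assumes k: "0 < k"
  shows "fst (in_YT \<phi> vs k pre) \<longleftrightarrow>
    (\<forall>v\<in>set pre. \<forall>e\<in>hyperedges (set vs) k. v \<in> e \<longrightarrow> \<not> monochromatic \<phi> e)"
proof -
  have "fst (badT \<phi> vs k v vs) \<longleftrightarrow> (\<exists>e\<in>hyperedges (set vs) k. v \<in> e \<and> monochromatic \<phi> e)" for v
  proof
    assume "\<exists>e\<in>hyperedges (set vs) k. v \<in> e \<and> monochromatic \<phi> e"
    then obtain d u where "segment k d u \<in> hyperedges (set vs) k" "v \<in> segment k d u"
      "monochromatic \<phi> (segment k d u)"
      unfolding hyperedges_segment by blast
    moreover from this have "u \<in> set vs"
      using start_mem_segment[OF k, of u d] segment_mem_hyperedges by blast
    ultimately show "fst (badT \<phi> vs k v vs)" unfolding fst_badT[OF k] by blast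
  qed (auto simp: fst_badT[OF k])
  then show ?thesis by (induction pre) auto
qed

lemma Y_avoiding: "Y V k c t = avoiding V k c (set (take t (vertex_order V)))"
  by (simp add: Y_def avoiding_def)

lemma mem_Y_iff:
  "0 < k \<Longrightarrow> \<phi> \<in> colourings (set vs) c \<Longrightarrow>
    \<phi> \<in> Y (set vs) k c t \<longleftrightarrow> fst (in_YT \<phi> vs k (take t (vertex_order (set vs))))"
  by (simp add: Y_def fst_in_YT)

lemma finite_Y: "finite V \<Longrightarrow> finite (Y V k c t)"
  unfolding Y_def by (simp add: colourings_finite)

lemma Y_0: "Y V k c 0 = colourings V c"
  by (simp add: Y_def)

lemma Y_Suc_subset: "Y V k c (Suc t) \<subseteq> Y V k c t"
  unfolding Y_def using set_take_subset_set_take[of t "Suc t" "vertex_order V"] by auto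

text \<open>Every hyperedge contains a vertex, so a colouring without monochromatic hyperedges through any vertex
  has no monochromatic hyperedge at all.\<close>

lemma Y_length:
  assumes "distinct vs" "0 < k"
  shows "Y (set vs) k c (length vs) = stable_colourings (set vs) k c"
proof -
  have meets: "\<exists>v\<in>set vs. v \<in> e" if "e \<in> hyperedges (set vs) k" for e
    using that start_mem_segment[OF assms(2)] unfolding hyperedges_segment by blast
  then have "(\<forall>v\<in>set vs. \<forall>e\<in>hyperedges (set vs) k. v \<in> e \<longrightarrow> \<not> monochromatic \<phi> e) \<longleftrightarrow>
      (\<forall>e\<in>hyperedges (set vs) k. \<not> monochromatic \<phi> e)" for \<phi> :: colouring
    by meson
  moreover have "set (take (length vs) (vertex_order (set vs))) = set vs"
    by (simp add: vertex_order[OF assms(1)])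
  ultimately show ?thesis by (simp add: Y_def stable_colourings_def)
qed

lemma card_Y_le:
  assumes vs: "distinct vs" and t: "t < length vs" and "2 \<le> k" "2 < c"
  shows "card (Y (set vs) k c t) \<le> 4 * card (Y (set vs) k c (Suc t))"
proof -
  define ws where "ws = vertex_order (set vs)"
  have sorted: "sorted_wrt lex_less ws" and set: "set ws = set vs" and len: "length ws = length vs"
    using vertex_order[OF vs] by (simp_all add: ws_def)
  have v: "ws ! t \<in> set vs" using t len set by (metis nth_mem)
  have "set (take t ws) = {w \<in> set vs. lex_less w (ws ! t)}"
  proof -
    have "lex_less (ws ! i) (ws ! t) \<longleftrightarrow> i < t" if "i < length ws" for i
      using sorted that t len sorted_wrt_nth_less[OF sorted, of i t]
        sorted_wrt_nth_less[OF sorted, of t i]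
      by (metis lex_less_asym linorder_neqE_nat)
    moreover have "set (take t ws) = (!) ws ` {0..<t}" "set vs = (!) ws ` {0..<length ws}"
      using t len set nth_image[of t ws] nth_image[of "length ws" ws] by simp_all
    ultimately show ?thesis using t len by (auto simp: image_iff)
  qed
  moreover have "take (Suc t) ws = take t ws @ [ws ! t]" using t len by (simp add: take_Suc_conv_app_nth)
  ultimately show ?thesis
    using card_avoiding_below_le[OF _ v] assms by (simp add: Y_avoiding ws_def)
qed

section \<open>Distribution of the estimate\<close>

text \<open>For the quality of the output the clock is irrelevant: on first components the timed monadic
  operations are those of the monad of distributions.\<close>

abbreviation results :: "'a rtimed \<Rightarrow> 'a pmf" where
  "results m \<equiv> map_pmf fst m"

lemma results_det [simp]: "results (det m) = return_pmf (fst m)"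
  by (simp add: det_def)

lemma results_rbind [simp]:
  "results (m \<bind>\<^sub>r f) = bind_pmf (results m) (\<lambda>x. results (f x))"
  by (simp add: rbind_def map_bind_pmf bind_map_pmf case_prod_unfold pmf.map_comp o_def)

lemma sampler_uniform:
  assumes "poly_time_uniform_sampler S" "(vs, k, c) \<in> instances" "t \<le> length vs"
    "Y (set vs) k c t \<noteq> {}"
  shows "results (S (vs, k, c) t) = pmf_of_set (Y (set vs) k c t)"
  using assms unfolding poly_time_uniform_sampler_def by fastforce

lemma map_mem_pmf_of_set:
  assumes "finite A" "A \<noteq> {}" "B \<subseteq> A"
  shows "map_pmf (\<lambda>x. x \<in> B) (pmf_of_set A) = bernoulli_pmf (real (card B) / real (card A))"
proof (rule pmf_eqI)
  have le: "real (card B) / real (card A) \<le> 1"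
    using assms card_mono[of A B] by (simp add: card_gt_0_iff)
  have "pmf (map_pmf (\<lambda>x. x \<in> B) (pmf_of_set A)) True = real (card B) / real (card A)"
    using assms by (simp add: pmf_map measure_pmf_of_set vimage_def Int_absorb1)
  also have "\<dots> = pmf (bernoulli_pmf (real (card B) / real (card A))) True" using le by simp
  finally have T: "pmf (map_pmf (\<lambda>x. x \<in> B) (pmf_of_set A)) True =
    pmf (bernoulli_pmf (real (card B) / real (card A))) True" .
  show "pmf (map_pmf (\<lambda>x. x \<in> B) (pmf_of_set A)) b =
    pmf (bernoulli_pmf (real (card B) / real (card A))) b" for b
    using T by (cases b) (simp_all only: pmf_False_conv_True)
qed

text \<open>Each trial draws uniformly from \<open>Y\<^sub>t\<close> and succeeds with probability \<open>|Y\<^sub>t\<^sub>+\<^sub>1| / |Y\<^sub>t|\<close>, independently of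
  the other ones.\<close>

lemma results_countT:
  assumes S: "poly_time_uniform_sampler S" and x: "(vs, k, c) \<in> instances" and t: "t < length vs"
    and ne: "Y (set vs) k c t \<noteq> {}"
  defines "p \<equiv> real (card (Y (set vs) k c (Suc t))) / real (card (Y (set vs) k c t))"
  shows "results (countT S (vs, k, c) (Suc t) (take (Suc t) (vertex_order (set vs))) r cnt) =
    map_pmf ((+) cnt) (binomial_pmf r p)"
proof -
  let ?A = "Y (set vs) k c t" and ?B = "Y (set vs) k c (Suc t)"
  let ?pre = "take (Suc t) (vertex_order (set vs))"
  have fin: "finite ?A" by (simp add: finite_Y)
  have p: "p \<in> {0..1}"
    using card_mono[OF fin Y_Suc_subset] ne fin by (simp add: p_def card_gt_0_iff)
  have k: "0 < k" using x by (auto simp: instances_def)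
  have unif: "results (S (vs, k, c) t) = pmf_of_set ?A"
    using sampler_uniform[OF S x _ ne] t by simp
  have mem: "\<phi> \<in> ?B \<longleftrightarrow> fst (in_YT \<phi> vs k ?pre)" if "\<phi> \<in> ?A" for \<phi>
    using that by (intro mem_Y_iff[OF k]) (simp add: Y_def)
  show ?thesis
  proof (induction r arbitrary: cnt)
    case 0
    then show ?case using p by (simp add: binomial_pmf_0)
  next
    case (Suc r)
    define C where "C b = map_pmf ((+) (if b then cnt + 1 else cnt)) (binomial_pmf r p)" for b
    have "results (countT S (vs, k, c) (Suc t) ?pre (Suc r) cnt) =
        bind_pmf (pmf_of_set ?A) (\<lambda>\<phi>. C (fst (in_YT \<phi> vs k ?pre)))"
      by (auto simp: unif bind_return_pmf C_def Suc.IH intro!: bind_pmf_cong)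
    also have "\<dots> = bind_pmf (pmf_of_set ?A) (\<lambda>\<phi>. C (\<phi> \<in> ?B))"
      using fin ne mem by (intro bind_pmf_cong) auto
    also have "\<dots> = bind_pmf (map_pmf (\<lambda>\<phi>. \<phi> \<in> ?B) (pmf_of_set ?A)) C"
      by (simp add: bind_map_pmf)
    also have "\<dots> = bind_pmf (bernoulli_pmf p) C"
      using fin ne by (simp add: map_mem_pmf_of_set Y_Suc_subset p_def)
    also have "\<dots> = map_pmf ((+) cnt) (binomial_pmf (Suc r) p)"
      by (auto simp: binomial_pmf_Suc[OF p] map_bind_pmf map_pmf_def bind_assoc_pmf bind_return_pmf C_def
          intro!: bind_pmf_cong)
    finally show ?case .
  qed
qed

text \<open>The union bound for two successive random experiments, the second of which may depend on the outcome
  of the first.\<close>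

lemma prob_bind_pmf_ge:
  assumes E: "measure_pmf.prob M E \<ge> 1 - a" and b: "0 \<le> b"
    and F: "\<And>x. x \<in> set_pmf M \<Longrightarrow> x \<in> E \<Longrightarrow> measure_pmf.prob (f x) F \<ge> 1 - b"
  shows "measure_pmf.prob (bind_pmf M f) F \<ge> 1 - (a + b)"
proof -
  have "1 - (a + b) \<le> measure_pmf.prob M E - b" using E by simp
  also have "\<dots> = measure_pmf.expectation M (\<lambda>x. indicator E x - b)"
    by (subst Bochner_Integration.integral_diff) (auto intro: measure_pmf.integrable_const_bound[where B = 1])
  also have "\<dots> \<le> measure_pmf.expectation M (\<lambda>x. measure_pmf.prob (f x) F)"
  proof (rule integral_mono_AE)
    show "AE x in measure_pmf M. indicator E x - b \<le> measure_pmf.prob (f x) F"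
      using b F by (auto simp: AE_measure_pmf_iff indicator_def intro: order_trans[OF _ measure_nonneg])
    have "\<bar>indicator E x - b\<bar> \<le> 1 + b" for x
      using b by (auto simp: indicator_def)
    moreover have "measure_pmf.prob (f x) F \<le> 1 + b" for x
      by (rule order_trans[OF measure_pmf.prob_le_1]) (use b in simp)
    ultimately show "integrable M (\<lambda>x. indicator E x - b)" "integrable M (\<lambda>x. measure_pmf.prob (f x) F)"
      by (auto intro!: measure_pmf.integrable_const_bound[where B = "1 + b"])
  qed
  also have "\<dots> = measure_pmf.prob (bind_pmf M f) F"
    using arg_cong[OF map_bind_pmf[of "\<lambda>z. z \<in> F" M f], of "\<lambda>N. pmf N True"]
    by (simp add: pmf_bind pmf_map vimage_def)
  finally show ?thesis .
qed

lemma T_sample_ge: "54 * (real n / \<epsilon>)\<^sup>2 * ln (2 * real n / \<delta>) \<le> real (T_sample n \<epsilon> \<delta>)"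
  unfolding T_sample_def by linarith

lemma T_sample_pos:
  assumes "0 < n" "0 < \<epsilon>" "0 < \<delta>" "\<delta> < 1"
  shows "0 < T_sample n \<epsilon> \<delta>"
proof -
  have "1 < 2 * real n / \<delta>" using assms by (simp add: field_simps)
  then have "0 < 54 * (real n / \<epsilon>)\<^sup>2 * ln (2 * real n / \<delta>)" using assms by (simp add: field_simps)
  then have "0 < real (T_sample n \<epsilon> \<delta>)" using T_sample_ge[of n \<epsilon> \<delta>] by linarith
  then show ?thesis by simp
qed

text \<open>For \<open>p \<ge> 1/4\<close> a relative error \<open>\<eta>\<close> is an absolute error of at least \<open>\<eta>/4\<close>. The Hoeffding exponent
  \<open>2 \<eta>\<^sup>2 p\<^sup>2 T\<close> is then at least \<open>2 \<sqdot> (\<epsilon>/2n)\<^sup>2 \<sqdot> (1/4)\<^sup>2 \<sqdot> 54 (n/\<epsilon>)\<^sup>2 \<sqdot> ln (2n/\<delta>)\<close>, that is \<open>27/16\<close> times the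
  logarithm, which alone would make the two-sided failure probability equal to \<open>\<delta>/n\<close>.\<close>

lemma binomial_relative_error:
  assumes p: "1/4 \<le> p" "p \<le> 1" and n: "0 < n" and \<epsilon>: "0 < \<epsilon>" and \<delta>: "0 < \<delta>" "\<delta> < 1"
  defines "T \<equiv> T_sample n \<epsilon> \<delta>" and "\<eta> \<equiv> \<epsilon> / (2 * real n)"
  shows "measure_pmf.prob (binomial_pmf T p)
    {j. (1 - \<eta>) * (p * T) \<le> real j \<and> real j \<le> (1 + \<eta>) * (p * T)} \<ge> 1 - \<delta> / n"
proof -
  define L where "L = ln (2 * real n / \<delta>)"
  define s where "s = \<eta> * (p * T)"
  have T: "0 < T" using T_sample_pos[of n \<epsilon> \<delta>] assms by simp
  have L: "0 < L" using n \<delta> by (simp add: L_def field_simps)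
  have \<eta>: "0 < \<eta>" using n \<epsilon> by (simp add: \<eta>_def)
  interpret binom: binomial_distribution T p using p by unfold_locales auto
  have "L \<le> 27 / 16 * L" using L by simp
  also have "\<dots> = 2 * \<eta>\<^sup>2 * (1/4)\<^sup>2 * (54 * (real n / \<epsilon>)\<^sup>2 * L)"
    using n \<epsilon> by (simp add: \<eta>_def field_simps power2_eq_square)
  also have "\<dots> \<le> 2 * \<eta>\<^sup>2 * p\<^sup>2 * T"
  proof (intro mult_mono)
    show "(1/4)\<^sup>2 \<le> p\<^sup>2" using p by (intro power_mono) auto
    show "54 * (real n / \<epsilon>)\<^sup>2 * L \<le> T" using T_sample_ge[of n \<epsilon> \<delta>] by (simp add: T_def L_def)
  qed (use L in auto)
  also have "\<dots> = 2 * s\<^sup>2 / T"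
    using T by (simp add: s_def power2_eq_square field_simps)
  finally have "exp (- 2 * s\<^sup>2 / T) \<le> exp (- L)" by simp
  also have "exp (- L) = \<delta> / (2 * n)"
    using n \<delta> by (simp add: L_def exp_minus)
  finally have "2 * exp (- 2 * s\<^sup>2 / T) \<le> \<delta> / n" by simp
  with binom.prob_abs_ge[OF T, of s] have "measure_pmf.prob (binomial_pmf T p) {j. s \<le> \<bar>real j - T * p\<bar>} \<le> \<delta> / n"
    using \<eta> p by (simp add: s_def)
  then have "1 - \<delta> / n \<le> measure_pmf.prob (binomial_pmf T p) (UNIV - {j. s \<le> \<bar>real j - T * p\<bar>})"
    by (subst measure_pmf.prob_compl[of _ "binomial_pmf T p", simplified]) auto
  also have "\<dots> \<le> measure_pmf.prob (binomial_pmf T p)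
      {j. (1 - \<eta>) * (p * T) \<le> real j \<and> real j \<le> (1 + \<eta>) * (p * T)}"
    by (rule measure_pmf.finite_measure_mono) (auto simp: s_def algebra_simps abs_less_iff not_le)
  finally show ?thesis .
qed

context
  fixes S :: sampler and vs :: "vertex list" and k c :: nat and \<epsilon> \<delta> \<eta> :: real and T n :: nat
  assumes S: "poly_time_uniform_sampler S" and inst: "(vs, k, c) \<in> instances"
    and \<epsilon>: "0 < \<epsilon>" "\<epsilon> \<le> 1" and \<delta>: "0 < \<delta>" "\<delta> < 1"
  defines "n \<equiv> length vs" and "T \<equiv> T_sample n \<epsilon> \<delta>" and "\<eta> \<equiv> \<epsilon> / (2 * real n)"
begin

lemma instD: "distinct vs" "0 < k" "2 < c"
  using inst by (auto simp: instances_def)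

abbreviation "num_Y t \<equiv> card (Y (set vs) k c t)"
abbreviation "run_levels \<equiv> levelsT S (vs, k, c) (vertex_order (set vs))"

lemma y_pos:
  assumes "2 \<le> k" shows "t \<le> n \<Longrightarrow> 0 < num_Y t"
proof (induction t)
  case 0
  then show ?case using instD by (simp add: Y_0 card_colourings)
next
  case (Suc t)
  then show ?case using card_Y_le[of vs t k c] instD assms by (simp add: n_def)
qed

text \<open>The \<open>r\<close> levels above \<open>t\<close> multiply the numerator by about \<open>T\<^sup>r |Y\<^sub>n| / |Y\<^sub>t|\<close>, where each level
  contributes a relative error \<open>\<eta>\<close> and a failure probability \<open>\<delta> / n\<close>. The inequalities are multiplied by
  \<open>|Y\<^sub>t|\<close>, so that the telescoping ratios cancel in the induction step.\<close>

lemma levels_accurate: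
  assumes k: "2 \<le> k"
  shows "t + r = n \<Longrightarrow> measure_pmf.prob (results (run_levels T r (Suc t) a b))
    {(a', b'). b' = b * T ^ r \<and>
       (1 - \<eta>) ^ r * (a * T ^ r * num_Y n) \<le> real a' * num_Y t \<and>
       real a' * num_Y t \<le> (1 + \<eta>) ^ r * (a * T ^ r * num_Y n)} \<ge> 1 - r * (\<delta> / n)"
proof (induction r arbitrary: t a b)
  case 0
  then show ?case by simp
next
  case (Suc r)
  define p where "p = real (num_Y (Suc t)) / real (num_Y t)"
  define E where "E = {j. (1 - \<eta>) * (p * T) \<le> real j \<and> real j \<le> (1 + \<eta>) * (p * T)}"
  have t: "t < length vs" using Suc.prems by (simp add: n_def)
  have n: "0 < n" using Suc.prems by simp
  have \<eta>: "0 < \<eta>" "\<eta> < 1" using \<epsilon> n by (simp_all add: \<eta>_def)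
  have y0: "0 < num_Y t" and y1: "0 < num_Y (Suc t)" using y_pos[OF k] Suc.prems by simp_all
  have p: "1 / 4 \<le> p" "p \<le> 1"
    using card_Y_le[OF instD(1) t k instD(3)] y0 card_mono[OF finite_Y Y_Suc_subset, of "set vs" k c t]
    by (simp_all add: p_def field_simps flip: of_nat_mult)
  have "results (run_levels T (Suc r) (Suc t) a b) =
      bind_pmf (binomial_pmf T p) (\<lambda>j. results (run_levels T r (Suc (Suc t)) (a * j) (b * T)))"
  proof -
    have "map_pmf ((+) 0) (binomial_pmf T p) = binomial_pmf T p"
      by (simp add: map_pmf_def bind_return_pmf')
    then have "results (countT S (vs, k, c) (Suc t) (take (Suc t) (vertex_order (set vs))) T 0) =
        binomial_pmf T p"
      using results_countT[OF S inst t, of T 0] y0 by (simp add: p_def card_gt_0_iff)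
    then show ?thesis by (simp add: bind_return_pmf)
  qed
  moreover have "measure_pmf.prob (bind_pmf (binomial_pmf T p)
      (\<lambda>j. results (run_levels T r (Suc (Suc t)) (a * j) (b * T))))
    {(a', b'). b' = b * T ^ Suc r \<and>
       (1 - \<eta>) ^ Suc r * (a * T ^ Suc r * num_Y n) \<le> real a' * num_Y t \<and>
       real a' * num_Y t \<le> (1 + \<eta>) ^ Suc r * (a * T ^ Suc r * num_Y n)} \<ge> 1 - (\<delta> / n + r * (\<delta> / n))"
  proof (rule prob_bind_pmf_ge)
    show "measure_pmf.prob (binomial_pmf T p) E \<ge> 1 - \<delta> / n"
      using binomial_relative_error[OF p n \<epsilon>(1) \<delta>] by (simp add: E_def T_def \<eta>_def)
    show "0 \<le> r * (\<delta> / n)" using \<delta> by simp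
    fix j assume "j \<in> E"
    then have j: "(1 - \<eta>) * (num_Y (Suc t) * T) \<le> j * num_Y t" "j * num_Y t \<le> (1 + \<eta>) * (num_Y (Suc t) * T)"
      using y0 by (simp_all add: E_def p_def field_simps)
    have lower: "(1 - \<eta>) ^ Suc r * (a * T ^ Suc r * num_Y n) \<le> real a' * num_Y t"
      if "(1 - \<eta>) ^ r * ((a * j) * T ^ r * num_Y n) \<le> real a' * num_Y (Suc t)" for a'
    proof -
      let ?q = "(1 - \<eta>) ^ r * (a * T ^ r * num_Y n)"
      have "(1 - \<eta>) ^ Suc r * (a * T ^ Suc r * num_Y n) * num_Y (Suc t) = ?q * ((1 - \<eta>) * (num_Y (Suc t) * T))"
        by simp
      also have "\<dots> \<le> ?q * (j * num_Y t)" using j(1) \<eta> by (intro mult_left_mono) auto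
      also have "\<dots> = (1 - \<eta>) ^ r * ((a * j) * T ^ r * num_Y n) * num_Y t" by simp
      also have "\<dots> \<le> real a' * num_Y (Suc t) * num_Y t" using that by (intro mult_right_mono) auto
      also have "\<dots> = real a' * num_Y t * num_Y (Suc t)" by simp
      finally show ?thesis using y1 by (simp only: mult_le_cancel_right_pos of_nat_0_less_iff)
    qed
    have upper: "real a' * num_Y t \<le> (1 + \<eta>) ^ Suc r * (a * T ^ Suc r * num_Y n)"
      if "real a' * num_Y (Suc t) \<le> (1 + \<eta>) ^ r * ((a * j) * T ^ r * num_Y n)" for a'
    proof -
      let ?q = "(1 + \<eta>) ^ r * (a * T ^ r * num_Y n)"
      have "real a' * num_Y t * num_Y (Suc t) = real a' * num_Y (Suc t) * num_Y t" by simp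
      also have "\<dots> \<le> (1 + \<eta>) ^ r * ((a * j) * T ^ r * num_Y n) * num_Y t"
        using that by (intro mult_right_mono) auto
      also have "\<dots> = ?q * (j * num_Y t)" by simp
      also have "\<dots> \<le> ?q * ((1 + \<eta>) * (num_Y (Suc t) * T))" using j(2) \<eta> by (intro mult_left_mono) auto
      also have "\<dots> = (1 + \<eta>) ^ Suc r * (a * T ^ Suc r * num_Y n) * num_Y (Suc t)" by simp
      finally show ?thesis using y1 by (simp only: mult_le_cancel_right_pos of_nat_0_less_iff)
    qed
    have "1 - r * (\<delta> / n) \<le> measure_pmf.prob (results (run_levels T r (Suc (Suc t)) (a * j) (b * T)))
      {(a', b'). b' = b * T * T ^ r \<and>
       (1 - \<eta>) ^ r * ((a * j) * T ^ r * num_Y n) \<le> real a' * num_Y (Suc t) \<and>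
       real a' * num_Y (Suc t) \<le> (1 + \<eta>) ^ r * ((a * j) * T ^ r * num_Y n)}" (is "_ \<le> measure_pmf.prob _ ?X")
      using Suc.IH[of "Suc t" "a * j" "b * T"] Suc.prems by simp
    also have "\<dots> \<le> measure_pmf.prob (results (run_levels T r (Suc (Suc t)) (a * j) (b * T)))
      {(a', b'). b' = b * T ^ Suc r \<and>
       (1 - \<eta>) ^ Suc r * (a * T ^ Suc r * num_Y n) \<le> real a' * num_Y t \<and>
       real a' * num_Y t \<le> (1 + \<eta>) ^ Suc r * (a * T ^ Suc r * num_Y n)}" (is "_ \<le> measure_pmf.prob _ ?Y")
    proof (rule measure_pmf.finite_measure_mono)
      have "b * T * T ^ r = b * T ^ Suc r" by simp
      with lower upper show "?X \<subseteq> ?Y"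
        unfolding subset_iff split_paired_All mem_Collect_eq case_prod_conv by metis
    qed simp
    finally show "1 - r * (\<delta> / n) \<le> \<dots>" .
  qed
  ultimately show ?case by (simp add: algebra_simps add_divide_distrib)
qed

text \<open>An empty level makes the running product zero; the samples drawn afterwards, from whatever distribution,
  cannot change it. This is the situation for \<open>k = 1\<close>.\<close>

lemma levels_zero: "ab \<in> set_pmf (results (run_levels T r t 0 b)) \<Longrightarrow> fst ab = 0"
  by (induction r arbitrary: t b) (auto simp: bind_return_pmf)

lemma results_splitting_estimate:
  "results (splitting_estimate S (vs, k, c) \<epsilon> \<delta>) =
    map_pmf (\<lambda>(a, b). real (a * c ^ n) / real b) (results (run_levels T n 1 1 1))"
  by (simp add: splitting_estimate_def multilevel_splitting_def bind_return_pmf fst_sortT instD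
      case_prod_unfold n_def T_def flip: map_pmf_def)

lemma estimate_accurate:
  "measure_pmf.prob (results (splitting_estimate S (vs, k, c) \<epsilon> \<delta>))
    {z. (1 - \<epsilon>) * num_stable (set vs) k c \<le> z \<and> z \<le> (1 + \<epsilon>) * num_stable (set vs) k c} \<ge> 1 - \<delta>"
    (is "measure_pmf.prob _ ?G \<ge> _")
proof -
  have yn: "num_Y n = num_stable (set vs) k c"
    using Y_length[OF instD(1,2)] by (simp add: num_stable_def n_def)
  have y0: "num_Y 0 = c ^ n"
    using instD by (simp add: Y_0 card_colourings n_def distinct_card)
  consider "n = 0" | "k = 1" "0 < n" | "2 \<le> k" "0 < n" using instD(2) by linarith
  then show ?thesis
  proof cases
    case 1
    then have "num_stable (set vs) k c = 1" using y0 yn by simp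
    then show ?thesis using 1 \<epsilon> \<delta> by (simp add: results_splitting_estimate)
  next
    case 2
    have len: "0 < length vs" using 2 by (simp add: n_def)
    have emp: "Y (set vs) k c t = {}" if "0 < t" "t \<le> n" for t
    proof -
      define ws where "ws = vertex_order (set vs)"
      have ws: "length ws = n" "set ws = set vs" using vertex_order[OF instD(1)] by (simp_all add: ws_def n_def)
      then obtain v ws' where v: "ws = v # ws'" using 2 by (cases ws) auto
      have "v \<in> set (take t (vertex_order (set vs)))"
        using that v by (cases t) (simp_all flip: ws_def)
      moreover have "segment k True v = {v}" using 2 by (simp add: segment_shift shift_def lessThan_Suc)
      then have "{v} \<in> hyperedges (set vs) k"
        using segment_mem_hyperedges[of k True v "set vs"] v ws by auto
      moreover have "monochromatic \<phi> {v}" for \<phi> by (simp add: monochromatic_def)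
      ultimately show ?thesis unfolding Y_def by blast
    qed
    have "results (run_levels T n 1 1 1) = results (run_levels T (n - 1) 2 0 T)"
    proof -
      have "results (countT S (vs, k, c) 1 (take 1 (vertex_order (set vs))) T 0) = return_pmf 0"
      proof -
        have "Y (set vs) k c 0 \<noteq> {}" by (rule notI) (use y0 instD(3) in simp)
        moreover have "binomial_pmf T 0 = return_pmf 0"
          using set_pmf_subset_singleton[of "binomial_pmf T 0" 0] by simp
        ultimately show ?thesis
          using results_countT[OF S inst len, of T 0] emp[of 1] 2 by simp
      qed
      then show ?thesis using 2 by (cases n) (simp_all add: bind_return_pmf numeral_2_eq_2)
    qed
    then have "set_pmf (results (splitting_estimate S (vs, k, c) \<epsilon> \<delta>)) \<subseteq> {0}"
      using levels_zero by (force simp: results_splitting_estimate)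
    then have "results (splitting_estimate S (vs, k, c) \<epsilon> \<delta>) = return_pmf 0"
      by (simp only: set_pmf_subset_singleton)
    moreover have "num_stable (set vs) k c = 0" using yn emp[of n] 2 by simp
    ultimately show ?thesis using \<delta> by simp
  next
    case 3
    have T: "0 < T" using T_sample_pos 3 \<epsilon> \<delta> by (simp add: T_def)
    have \<eta>: "0 < \<eta>" "\<eta> < 1" "n * \<eta> = \<epsilon> / 2" using \<epsilon> 3 by (simp_all add: \<eta>_def)
    have lower: "1 - \<epsilon> \<le> (1 - \<eta>) ^ n"
      using Bernoulli_inequality[of "- \<eta>" n] \<eta> \<epsilon> by simp
    have upper: "(1 + \<eta>) ^ n \<le> 1 + \<epsilon>"
    proof -
      have "(1 + \<eta>) ^ n \<le> exp \<eta> ^ n" using \<eta> by (intro power_mono) (auto intro: exp_ge_add_one_self)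
      also have "\<dots> = exp (\<epsilon> / 2)" using \<eta> by (simp add: exp_of_nat_mult[symmetric])
      also have "\<dots> \<le> 1 + \<epsilon> / 2 + (\<epsilon> / 2)\<^sup>2" using \<epsilon> by (intro exp_bound) auto
      also have "\<dots> \<le> 1 + \<epsilon>"
      proof -
        have "\<epsilon> * \<epsilon> \<le> \<epsilon>" using \<epsilon> by (simp add: mult_left_le)
        moreover have "(\<epsilon> / 2)\<^sup>2 = \<epsilon> * \<epsilon> / 4" by (simp add: power2_eq_square)
        ultimately show ?thesis using \<epsilon> by linarith
      qed
      finally show ?thesis .
    qed
    \<comment> \<open>The factor \<open>c\<^sup>n\<close> of the estimate is \<open>|Y\<^sub>0|\<close>, so the relation between numerator and ratios becomes one between the output and \<open>|Y\<^sub>n|\<close>.\<close>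
    have good: "real (a * c ^ n) / real (T ^ n) \<in> ?G"
      if l: "(1 - \<eta>) ^ n * (1 * T ^ n * num_Y n) \<le> real a * num_Y 0"
        and u: "real a * num_Y 0 \<le> (1 + \<eta>) ^ n * (1 * T ^ n * num_Y n)" for a
    proof -
      have "(1 - \<epsilon>) * num_Y n \<le> (1 - \<eta>) ^ n * num_Y n" using lower by (intro mult_right_mono) auto
      also have "\<dots> \<le> real (a * c ^ n) / real (T ^ n)"
        using l T y0 by (simp add: field_simps)
      finally have "(1 - \<epsilon>) * num_Y n \<le> real (a * c ^ n) / real (T ^ n)" .
      moreover have "real (a * c ^ n) / real (T ^ n) \<le> (1 + \<eta>) ^ n * num_Y n"
        using u T y0 by (simp add: field_simps)
      then have "real (a * c ^ n) / real (T ^ n) \<le> (1 + \<epsilon>) * num_Y n"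
        using mult_right_mono[OF upper, of "real (num_Y n)"] by simp
      ultimately show ?thesis unfolding yn by blast
    qed
    have "1 - \<delta> \<le> measure_pmf.prob (results (run_levels T n 1 1 1))
      {(a', b'). b' = 1 * T ^ n \<and>
       (1 - \<eta>) ^ n * (1 * T ^ n * num_Y n) \<le> real a' * num_Y 0 \<and>
       real a' * num_Y 0 \<le> (1 + \<eta>) ^ n * (1 * T ^ n * num_Y n)}" (is "_ \<le> measure_pmf.prob _ ?X")
      using levels_accurate[OF 3(1), of 0 n 1 1] 3 by simp
    also have "\<dots> \<le> measure_pmf.prob (results (run_levels T n 1 1 1))
       ((\<lambda>(a, b). real (a * c ^ n) / real b) -` ?G)"
    proof (rule measure_pmf.finite_measure_mono)
      show "?X \<subseteq> (\<lambda>(a, b). real (a * c ^ n) / real b) -` ?G"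
        unfolding subset_iff split_paired_All mem_Collect_eq case_prod_conv vimage_eq mult_1
        using good unfolding mem_Collect_eq mult_1 by blast
    qed simp
    finally show ?thesis by (simp add: results_splitting_estimate)
  qed
qed

end

section \<open>Running time\<close>

lemma bitlen_pos: "1 \<le> bitlen n"
  by (subst bitlen_def, subst bits.simps) simp

lemma bitlen_step: "2 \<le> n \<Longrightarrow> bitlen n = Suc (bitlen (n div 2))"
  by (subst bitlen_def, subst bits.simps) (simp add: bitlen_def)

lemma bitlen_small: "n < 2 \<Longrightarrow> bitlen n = 1"
  by (subst bitlen_def, subst bits.simps) simp

lemma bitlen_le: "n < 2 ^ b \<Longrightarrow> 1 \<le> b \<Longrightarrow> bitlen n \<le> b"
proof (induction b arbitrary: n)
  case (Suc b)
  show ?case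
  proof (cases "n < 2")
    case False
    then have "1 \<le> b" using Suc.prems by (cases b) auto
    then have "bitlen (n div 2) \<le> b" using Suc.prems by (intro Suc.IH) auto
    then show ?thesis using False by (simp add: bitlen_step)
  qed (simp add: bitlen_small)
qed simp

lemma less_exp_bitlen: "n < 2 ^ bitlen n"
proof (induction n rule: less_induct)
  case (less n)
  show ?case
  proof (cases "n < 2")
    case False
    then have "n div 2 < 2 ^ bitlen (n div 2)" by (intro less) auto
    then show ?thesis using False by (simp add: bitlen_step)
  qed (simp add: bitlen_small)
qed

lemma bitlen_mono: "m \<le> n \<Longrightarrow> bitlen m \<le> bitlen n"
  by (intro bitlen_le bitlen_pos) (use less_exp_bitlen[of n] in linarith)

lemma bitlen_mult: "bitlen (m * n) \<le> bitlen m + bitlen n"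
proof (rule bitlen_le)
  show "m * n < 2 ^ (bitlen m + bitlen n)"
    using less_exp_bitlen[of m] less_exp_bitlen[of n] by (simp add: power_add mult_strict_mono')
qed (use bitlen_pos[of m] in simp)

lemma bitlen_le_Suc: "bitlen n \<le> Suc n"
proof (rule bitlen_le)
  show "n < 2 ^ Suc n" by (rule less_trans[OF less_exp]) simp
qed simp

lemma bitlen_1 [simp]: "bitlen 1 = 1" "bitlen (Suc 0) = 1" "bitlen 0 = 1"
  by (simp_all add: bitlen_small)

lemma snd_tret [simp]: "snd (tret x) = 1" by (simp add: tret_def)

lemma snd_tbind [simp]: "snd (m \<bind>\<^sub>t f) = snd m + snd (f (fst m))" by (simp add: tbind_def)

lemma snd_primitives [simp]:
  "snd (eqT a b) = bitlen a + bitlen b" "snd (leT a b) = bitlen a + bitlen b"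
  "snd (lessT a b) = bitlen a + bitlen b" "snd (addT a b) = bitlen a + bitlen b"
  "snd (subT a b) = bitlen a + bitlen b" "snd (mulT a b) = bitlen a * bitlen b"
  "snd (copyT v) = bitlen (fst v) + bitlen (snd v)"
  "snd (T_sampleT n \<epsilon> \<delta>) = 9 + bitlen (T_sample n \<epsilon> \<delta>)"
  by (simp_all add: eqT_def leT_def lessT_def addT_def subT_def mulT_def copyT_def T_sampleT_def)

text \<open>Step counts of the subroutines in terms of a bound \<open>b\<close> on the number of vertices and on the bit lengths
  of the numbers in the input, a bound \<open>u\<close> on the sample size and its bit length, and a bound \<open>q\<close> on the time
  of one call of the sampler. They are polynomial expressions over an arbitrary commutative semiring: on the
  natural numbers they bound the running time, on real polynomials they are the polynomial that the definition
  of an approximation scheme asks for.\<close>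

definition lookup_bound :: "'a::comm_semiring_1 \<Rightarrow> 'a" where
  "lookup_bound b = 4 * b * b + b"

definition walk_bound :: "'a::comm_semiring_1 \<Rightarrow> 'a" where
  "walk_bound b = (lookup_bound b + 4 * b + 3) * (b + 1)"

definition edge_bound :: "'a::comm_semiring_1 \<Rightarrow> 'a" where
  "edge_bound b = lookup_bound b + walk_bound b + 1"

definition bad_bound :: "'a::comm_semiring_1 \<Rightarrow> 'a" where
  "bad_bound b = 2 * b * (8 * b + 1 + edge_bound b) + 1"

definition member_bound :: "'a::comm_semiring_1 \<Rightarrow> 'a" where
  "member_bound b = b * bad_bound b + 1"

definition sort_bound :: "'a::comm_semiring_1 \<Rightarrow> 'a" where
  "sort_bound b = b * ((6 * b + 1) * b + 1) + 1"

definition take_bound :: "'a::comm_semiring_1 \<Rightarrow> 'a" where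
  "take_bound b = (4 * b + 3) * b + 1"

definition size_bound :: "'a::comm_semiring_1 \<Rightarrow> 'a \<Rightarrow> 'a" where
  "size_bound b u = 1 + b * u"

definition sample_bound :: "'a::comm_semiring_1 \<Rightarrow> 'a \<Rightarrow> 'a \<Rightarrow> 'a" where
  "sample_bound b u q = 2 * u + b + 3 + q + member_bound b"

definition level_bound :: "'a::comm_semiring_1 \<Rightarrow> 'a \<Rightarrow> 'a \<Rightarrow> 'a" where
  "level_bound b u q = 2 * b + 3 + take_bound b + u * sample_bound b u q + 2 * size_bound b u * u"

definition total_bound :: "'a::comm_semiring_1 \<Rightarrow> 'a \<Rightarrow> 'a \<Rightarrow> 'a" where
  "total_bound b u q = 2 * (b * (b + 1) + 1) + (9 + u) + sort_bound b + (b * level_bound b u q + 1) +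
     (b * (b + 1 + (size_bound b u + b * b) * b) + 1) + 2 * size_bound b u + b * b"

lemmas time_bound_defs = lookup_bound_def walk_bound_def edge_bound_def bad_bound_def
  member_bound_def sort_bound_def take_bound_def size_bound_def sample_bound_def level_bound_def
  total_bound_def

lemma mem_set_pmf_rbind:
  "(y, \<tau>) \<in> set_pmf (m \<bind>\<^sub>r f) \<longleftrightarrow>
    (\<exists>x s r. (x, s) \<in> set_pmf m \<and> (y, r) \<in> set_pmf (f x) \<and> \<tau> = s + r)"
  by (force simp: rbind_def)

lemma mem_set_pmf_det: "(x, s) \<in> set_pmf (det m) \<longleftrightarrow> x = fst m \<and> s = snd m"
  by (auto simp: det_def)

text \<open>The bound \<open>2 * N\<close> leaves room for the coordinates that exceed those of the vertices: the position after
  the last one of a walk, and the sum of a coordinate and \<open>k\<close> in the segment test.\<close>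

context
  fixes vs :: "vertex list" and k c N B :: nat
  assumes N: "2 * N < 2 ^ B" and B: "1 \<le> B" and N_pos: "1 \<le> N"
    and coords: "\<And>w. w \<in> set vs \<Longrightarrow> fst w \<le> N \<and> snd w \<le> N"
    and k_le: "k \<le> N" and c_le: "c \<le> N" and len_B: "length vs \<le> B" and len_N: "length vs \<le> N"
begin

lemma bitlen_le_B: "x \<le> 2 * N \<Longrightarrow> bitlen x \<le> B"
  using N B by (intro bitlen_le) auto

lemma lookup_time:
  assumes \<phi>: "\<And>w. w \<in> set vs \<Longrightarrow> \<phi> w \<le> N" and v: "fst v \<le> 2 * N" "snd v \<le> 2 * N"
  shows "snd (lookupT \<phi> vs v) \<le> lookup_bound B"
proof -
  have "snd (lookupT \<phi> ws v) \<le> 4 * B * length ws + B" if "set ws \<subseteq> set vs" for ws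
    using that
  proof (induction ws)
    case Nil
    then show ?case using B by simp
  next
    case (Cons w ws)
    then have "w \<in> set vs" by simp
    then have "bitlen (fst w) \<le> B" "bitlen (snd w) \<le> B" "bitlen (\<phi> w) \<le> B"
      using coords[of w] \<phi>[of w] by (simp_all add: bitlen_le_B)
    moreover have "bitlen (fst v) \<le> B" "bitlen (snd v) \<le> B" using v by (simp_all add: bitlen_le_B)
    moreover have "snd (lookupT \<phi> ws v) \<le> 4 * B * length ws + B" using Cons by simp
    ultimately show ?case by (simp add: algebra_simps)
  qed
  then have "snd (lookupT \<phi> vs v) \<le> 4 * B * length vs + B" by simp
  also have "\<dots> \<le> 4 * B * B + B" using len_B by simp
  finally show ?thesis by (simp add: lookup_bound_def)
qed

text \<open>Every successful round leaves behind one vertex, namely the current one, and moves towards the remaining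
  ones. So the number of vertices not yet passed in the direction of the walk bounds the number of rounds,
  irrespective of \<open>r\<close>.\<close>

lemma walk_time:
  assumes \<phi>: "\<And>w. w \<in> set vs \<Longrightarrow> \<phi> w \<le> N" and a: "a \<le> N"
    and r: "r \<le> N" and v: "fst v \<le> N + 1" "snd v \<le> N + 1"
  shows "snd (walkT \<phi> vs d a r v) \<le> walk_bound B"
proof -
  define pos where "pos v = (if d then fst v else snd v)" for v :: vertex
  define above where "above v = {w \<in> set vs. pos v \<le> pos w}" for v
  define R where "R = lookup_bound B + 4 * B + 3"
  have "snd (walkT \<phi> vs d a r v) \<le> R * (card (above v) + 1)"
    using r v
  proof (induction r arbitrary: v)
    case 0
    then show ?case by (simp add: R_def)
  next
    case (Suc r)
    have v: "fst v \<le> 2 * N" "snd v \<le> 2 * N" using Suc.prems N_pos by simp_all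
    have sub: "bitlen (Suc r) \<le> B" "bitlen a \<le> B" using Suc.prems a by (simp_all add: bitlen_le_B)
    note look = lookup_time[of \<phi> v, OF \<phi> v]
    have step: "snd (stepT d v) \<le> B + 2"
      using v by (simp add: stepT_def bitlen_le_B)
    show ?case
    proof (cases "v \<in> set vs")
      case False
      then show ?thesis using sub look by (simp add: fst_lookupT R_def)
    next
      case True
      have b: "bitlen (\<phi> v) \<le> B" using \<phi>[OF True] by (simp add: bitlen_le_B)
      let ?v = "shift d v 1"
      have "v \<in> above v" "v \<notin> above ?v" "above ?v \<subseteq> above v"
        using True by (auto simp: above_def pos_def shift_def)
      then have "above ?v \<subset> above v" by blast
      then have "card (above ?v) < card (above v)" by (intro psubset_card_mono) (simp_all add: above_def)
      then have "R * (card (above ?v) + 1) \<le> R * card (above v)" by (intro mult_le_mono) simp_all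
      moreover have "snd (walkT \<phi> vs d a r ?v) \<le> R * (card (above ?v) + 1)"
        using Suc.prems coords[OF True] by (intro Suc.IH) (simp_all add: shift_def)
      ultimately have "snd (walkT \<phi> vs d a r ?v) \<le> R * card (above v)" by simp
      then show ?thesis using True sub look step b
        by (simp add: fst_lookupT) (auto simp: R_def)
    qed
  qed
  also have "card (above v) \<le> B"
    using card_mono[of "set vs" "above v"] card_length[of vs] len_B by (simp add: above_def)
  finally show ?thesis by (simp add: walk_bound_def R_def)
qed

lemma mono_edge_time:
  assumes \<phi>: "\<And>w. w \<in> set vs \<Longrightarrow> \<phi> w \<le> N" and u: "u \<in> set vs"
  shows "snd (mono_edgeT \<phi> vs k d u) \<le> edge_bound B"
  using lookup_time[of \<phi> u, OF \<phi>] walk_time[of \<phi> "\<phi> u" k u d, OF \<phi> \<phi>[OF u] k_le] coords[OF u] u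
  by (simp add: mono_edgeT_def fst_lookupT edge_bound_def)

lemma on_edge_time:
  assumes "u \<in> set vs" "v \<in> set vs"
  shows "snd (on_edgeT k d u v) \<le> 8 * B + 1"
proof -
  have "fst u + k \<le> 2 * N" "snd u + k \<le> 2 * N" using coords[OF assms(1)] k_le by simp_all
  then have "bitlen (fst u + k) \<le> B" "bitlen (snd u + k) \<le> B" "bitlen k \<le> B"
    "bitlen (fst u) \<le> B" "bitlen (snd u) \<le> B" "bitlen (fst v) \<le> B" "bitlen (snd v) \<le> B"
    using coords[OF assms(1)] coords[OF assms(2)] k_le by (simp_all add: bitlen_le_B)
  then show ?thesis by (simp add: on_edgeT_def segmentT_def case_prod_unfold)
qed

lemma bad_time:
  assumes \<phi>: "\<And>w. w \<in> set vs \<Longrightarrow> \<phi> w \<le> N" and v: "v \<in> set vs"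
  shows "snd (badT \<phi> vs k v vs) \<le> bad_bound B"
proof -
  define M where "M = 8 * B + 1 + edge_bound B"
  have at: "snd (mono_edge_atT \<phi> vs k v d u) \<le> M" if "u \<in> set vs" for u d
    using on_edge_time[OF that v, of d] mono_edge_time[of \<phi> u d, OF \<phi> that]
    by (simp add: mono_edge_atT_def M_def edge_bound_def)
  have "snd (badT \<phi> vs k v us) \<le> 2 * length us * M + 1" if "set us \<subseteq> set vs" for us
    using that
  proof (induction us)
    case (Cons u us)
    have "0 < M" by (simp add: M_def)
    with Cons at[of u False] at[of u True] show ?case by simp
  qed simp
  then have "snd (badT \<phi> vs k v vs) \<le> 2 * length vs * M + 1" by simp
  also have "\<dots> \<le> 2 * B * M + 1" using len_B by simp
  finally show ?thesis by (simp add: bad_bound_def M_def)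
qed

lemma in_Y_time:
  assumes \<phi>: "\<And>w. w \<in> set vs \<Longrightarrow> \<phi> w \<le> N" and pre: "set pre \<subseteq> set vs" "length pre \<le> length vs"
  shows "snd (in_YT \<phi> vs k pre) \<le> member_bound B"
proof -
  have "snd (in_YT \<phi> vs k us) \<le> length us * bad_bound B + 1" if "set us \<subseteq> set vs" for us
    using that
  proof (induction us)
    case (Cons u us)
    with bad_time[of \<phi> u, OF \<phi>] show ?case by simp
  qed simp
  then have "snd (in_YT \<phi> vs k pre) \<le> length pre * bad_bound B + 1" using pre by simp
  also have "\<dots> \<le> B * bad_bound B + 1" using pre len_B by simp
  finally show ?thesis by (simp add: member_bound_def)
qed

lemma lex_time:
  assumes "u \<in> set vs" "v \<in> set vs"
  shows "snd (lexT u v) \<le> 6 * B"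
proof -
  have "bitlen (fst u) \<le> B" "bitlen (snd u) \<le> B" "bitlen (fst v) \<le> B" "bitlen (snd v) \<le> B"
    using coords[OF assms(1)] coords[OF assms(2)] by (simp_all add: bitlen_le_B)
  then show ?thesis using B by (simp add: lexT_def)
qed

lemma insert_time:
  "v \<in> set vs \<Longrightarrow> set ws \<subseteq> set vs \<Longrightarrow> snd (insertT v ws) \<le> (6 * B + 1) * length ws + 1"
proof (induction ws)
  case (Cons w ws)
  with lex_time[of v w] show ?case by simp
qed simp

lemma sort_time: "snd (sortT vs) \<le> sort_bound B"
proof -
  have "snd (sortT ws) \<le> length ws * ((6 * B + 1) * B + 1) + 1"
    if "set ws \<subseteq> set vs" "length ws \<le> B" for ws
    using that
  proof (induction ws)
    case (Cons w ws)
    then have "snd (insertT w (fst (sortT ws))) \<le> (6 * B + 1) * length ws + 1"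
      using insert_time[of w "fst (sortT ws)"] by (simp add: set_sortT length_sortT)
    also have "\<dots> \<le> (6 * B + 1) * B + 1" using Cons.prems by (intro add_mono mult_le_mono) simp_all
    finally show ?case using Cons by simp
  qed simp
  then have "snd (sortT vs) \<le> length vs * ((6 * B + 1) * B + 1) + 1" using len_B by simp
  also have "\<dots> \<le> B * ((6 * B + 1) * B + 1) + 1" using len_B by (intro add_mono mult_le_mono) simp_all
  finally show ?thesis by (simp add: sort_bound_def)
qed

lemma length_time: "snd (lengthT vs) \<le> B * (B + 1) + 1"
proof -
  have "snd (lengthT ws) \<le> length ws * (B + 1) + 1" if "length ws \<le> N" for ws
    using that
  proof (induction ws)
    case (Cons w ws)
    then have "bitlen (length ws) \<le> B" by (simp add: bitlen_le_B)
    with Cons show ?case by simp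
  qed simp
  then have "snd (lengthT vs) \<le> length vs * (B + 1) + 1" using len_N by simp
  also have "\<dots> \<le> B * (B + 1) + 1" using len_B by (intro add_mono mult_le_mono) simp_all
  finally show ?thesis .
qed

lemma take_time:
  assumes "t \<le> N" "set ws \<subseteq> set vs" "length ws \<le> B"
  shows "snd (takeT t ws) \<le> take_bound B"
proof -
  have "snd (takeT t ws) \<le> (4 * B + 3) * length ws + 1"
    using assms(1,2)
  proof (induction ws arbitrary: t)
    case (Cons w ws)
    then have "bitlen t \<le> B" "bitlen (fst w) \<le> B" "bitlen (snd w) \<le> B"
      using coords[of w] by (simp_all add: bitlen_le_B)
    moreover have "snd (takeT (t - 1) ws) \<le> (4 * B + 3) * length ws + 1"
      using Cons.prems by (intro Cons.IH) simp_all
    ultimately show ?case by simp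
  qed simp
  also have "\<dots> \<le> (4 * B + 3) * B + 1" using assms(3) by (intro add_mono mult_le_mono) simp_all
  finally show ?thesis by (simp add: take_bound_def)
qed

text \<open>The number \<open>Z\<close> is a budget for the bit length of the product: each of the \<open>r\<close> outstanding
  multiplications by \<open>c\<close> consumes at most \<open>B\<close> digits of it. The same device is used for the levels.\<close>

lemma mul_pow_time:
  assumes "bitlen a + r * B \<le> Z" "r \<le> N"
  shows "snd (mul_powT a c r) \<le> r * (B + 1 + Z * B) + 1"
    "bitlen (fst (mul_powT a c r)) \<le> Z"
proof -
  have c: "bitlen c \<le> B" using c_le by (simp add: bitlen_le_B)
  have "snd (mul_powT a c r) \<le> r * (B + 1 + Z * B) + 1 \<and> bitlen (fst (mul_powT a c r)) \<le> Z"
    using assms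
  proof (induction r arbitrary: a)
    case (Suc r)
    have "bitlen (a * c) \<le> bitlen a + B" using bitlen_mult[of a c] c by simp
    then have "bitlen (a * c) + r * B \<le> Z" using Suc.prems by simp
    then have IH: "snd (mul_powT (a * c) c r) \<le> r * (B + 1 + Z * B) + 1"
      "bitlen (fst (mul_powT (a * c) c r)) \<le> Z"
      using Suc.IH[of "a * c"] Suc.prems by simp_all
    have "bitlen (Suc r) \<le> B" using Suc.prems by (simp add: bitlen_le_B)
    moreover have "bitlen a * bitlen c \<le> Z * B" using Suc.prems c by (intro mult_le_mono) auto
    ultimately show ?case using IH by simp
  qed simp
  then show "snd (mul_powT a c r) \<le> r * (B + 1 + Z * B) + 1"
    "bitlen (fst (mul_powT a c r)) \<le> Z" by simp_all
qed

context
  fixes S :: sampler and T U Q :: nat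
  assumes S_time: "\<And>t \<phi> \<tau>. t \<le> length vs \<Longrightarrow> (\<phi>, \<tau>) \<in> set_pmf (S (vs, k, c) t) \<Longrightarrow> \<tau> \<le> Q"
    and S_col: "\<And>t \<phi> \<tau>. t \<le> length vs \<Longrightarrow> (\<phi>, \<tau>) \<in> set_pmf (S (vs, k, c) t) \<Longrightarrow>
      \<phi> \<in> colourings (set vs) c"
    and TU: "T < U" "bitlen T \<le> U"
begin

lemma count_time:
  assumes "(cnt', \<tau>) \<in> set_pmf (countT S (vs, k, c) t pre r cnt)" "cnt + r \<le> T" "t \<le> length vs"
    "set pre \<subseteq> set vs" "length pre \<le> length vs"
  shows "\<tau> \<le> r * sample_bound B U Q + 1 \<and> cnt' \<le> cnt + r"
  using assms(1,2)
proof (induction r arbitrary: cnt \<tau>)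
  case 0
  then show ?case by (auto simp: mem_set_pmf_det)
next
  case (Suc r)
  from Suc.prems(1) obtain \<phi> s \<tau>' where
    \<phi>: "(\<phi>, s) \<in> set_pmf (S (vs, k, c) (t - 1))"
    and rec: "(cnt', \<tau>') \<in> set_pmf (countT S (vs, k, c) t pre r
      (fst (if fst (in_YT \<phi> vs k pre) then addT cnt 1 else tret cnt)))"
    and \<tau>: "\<tau> = bitlen (Suc r) + bitlen 1 + (bitlen t + bitlen 1 + (s + (snd (in_YT \<phi> vs k pre) +
      (snd (if fst (in_YT \<phi> vs k pre) then addT cnt 1 else tret cnt) + \<tau>'))))"
    unfolding countT.simps mem_set_pmf_rbind mem_set_pmf_det prod.case
    by (auto simp only: fst_primitives snd_primitives)
  have t: "t - 1 \<le> length vs" using assms(3) by simp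
  have "\<phi> w \<le> N" if "w \<in> set vs" for w
  proof -
    have "\<phi> w \<in> {1..c}" using S_col[OF t \<phi>] that by (auto simp: colourings_def PiE_iff)
    then show ?thesis using c_le by simp
  qed
  then have "snd (in_YT \<phi> vs k pre) \<le> member_bound B" using in_Y_time assms(4,5) by blast
  moreover have "s \<le> Q" using S_time[OF t \<phi>] .
  moreover have "bitlen (Suc r) \<le> U" "bitlen cnt \<le> U"
    using Suc.prems(2) TU bitlen_mono[of "Suc r" T] bitlen_mono[of cnt T] by simp_all
  moreover have "bitlen t \<le> B" using assms(3) len_N by (simp add: bitlen_le_B)
  moreover have "\<tau>' \<le> r * sample_bound B U Q + 1 \<and>
      cnt' \<le> fst (if fst (in_YT \<phi> vs k pre) then addT cnt 1 else tret cnt) + r"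
    using Suc.prems(2) by (intro Suc.IH[OF rec]) simp
  ultimately show ?case unfolding \<tau>
    by (cases "fst (in_YT \<phi> vs k pre)") (simp_all add: sample_bound_def)
qed

lemma levels_time:
  assumes "((a', b'), \<tau>) \<in> set_pmf (levelsT S (vs, k, c) ws T r t a b)"
    "1 \<le> t \<and> t + r \<le> length vs + 1" "set ws \<subseteq> set vs" "length ws \<le> length vs"
    "bitlen a + r * U \<le> size_bound B U" "bitlen b + r * U \<le> size_bound B U"
  shows "\<tau> \<le> r * level_bound B U Q + 1 \<and> bitlen a' \<le> size_bound B U \<and> bitlen b' \<le> size_bound B U"
  using assms(1,2,5,6)
proof (induction r arbitrary: t a b \<tau>)
  case 0
  then show ?case by (auto simp: mem_set_pmf_det)
next
  case (Suc r)
  from Suc.prems(1) obtain cnt s \<tau>' where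
    cnt: "(cnt, s) \<in> set_pmf (countT S (vs, k, c) t (take t ws) T 0)"
    and rec: "((a', b'), \<tau>') \<in> set_pmf (levelsT S (vs, k, c) ws T r (Suc t) (a * cnt) (b * T))"
    and \<tau>: "\<tau> = bitlen (Suc r) + bitlen 1 + (snd (takeT t ws) + (s + (bitlen a * bitlen cnt +
      (bitlen b * bitlen T + (bitlen t + bitlen 1 + \<tau>')))))"
    unfolding levelsT.simps mem_set_pmf_rbind mem_set_pmf_det
    by (auto simp only: fst_primitives snd_primitives fst_takeT Suc_eq_plus1)
  have t: "t \<le> length vs" "Suc r \<le> N" using Suc.prems(2) len_N by simp_all
  have "s \<le> T * sample_bound B U Q + 1 \<and> cnt \<le> 0 + T"
    using assms(3,4) t by (intro count_time[OF cnt]) (auto dest: in_set_takeD)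
  moreover have "T * sample_bound B U Q \<le> U * sample_bound B U Q"
    using TU by (intro mult_le_mono1) simp
  ultimately have s: "s \<le> U * sample_bound B U Q + 1" and "cnt \<le> T" by linarith+
  then have cT: "bitlen cnt \<le> U" using TU bitlen_mono[of cnt T] by simp
  have "bitlen (a * cnt) + r * U \<le> size_bound B U" "bitlen (b * T) + r * U \<le> size_bound B U"
    using Suc.prems(3,4) cT TU bitlen_mult[of a cnt] bitlen_mult[of b T] by simp_all
  then have IH: "\<tau>' \<le> r * level_bound B U Q + 1 \<and> bitlen a' \<le> size_bound B U \<and> bitlen b' \<le> size_bound B U"
    using Suc.prems(2) by (intro Suc.IH[OF rec]) simp_all
  have "bitlen a * bitlen cnt \<le> size_bound B U * U" "bitlen b * bitlen T \<le> size_bound B U * U"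
    using Suc.prems(3,4) cT TU by (auto intro!: mult_le_mono)
  moreover have "snd (takeT t ws) \<le> take_bound B"
    using t len_N len_B assms(3,4) by (intro take_time) auto
  moreover have "bitlen (Suc r) \<le> B" "bitlen t \<le> B" using t len_N by (simp_all add: bitlen_le_B)
  ultimately show ?case using IH s unfolding \<tau> by (simp add: level_bound_def)
qed

lemma splitting_time:
  assumes out: "(z, \<tau>) \<in> set_pmf (splitting_estimate S (vs, k, c) \<epsilon> \<delta>)"
    and T: "T = T_sample (length vs) \<epsilon> \<delta>"
  shows "\<tau> \<le> total_bound B U Q"
proof -
  let ?n = "length vs" and ?ws = "fst (sortT vs)" and ?Z = "size_bound B U"
  from out obtain a b \<tau>' where
    lev: "((a, b), \<tau>') \<in> set_pmf (levelsT S (vs, k, c) ?ws T ?n 1 1 1)"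
    and \<tau>: "\<tau> = (snd (lengthT vs) + (9 + bitlen T + (snd (sortT vs) + \<tau>'))) +
      (snd (lengthT vs) + (snd (mul_powT a c ?n) + (bitlen (fst (mul_powT a c ?n)) + bitlen b)))"
    unfolding splitting_estimate_def multilevel_splitting_def prod.case mem_set_pmf_rbind mem_set_pmf_det T
    by (auto simp only: fst_primitives snd_primitives fst_lengthT fst_mul_powT prod.case
        mem_set_pmf_rbind mem_set_pmf_det fst_conv snd_conv)
  have nB: "?n * x \<le> B * x" for x using len_B by simp
  have "bitlen 1 + ?n * U \<le> ?Z" using nB[of U] by (simp add: size_bound_def)
  then have L: "\<tau>' \<le> ?n * level_bound B U Q + 1 \<and> bitlen a \<le> ?Z \<and> bitlen b \<le> ?Z"
    by (intro levels_time[OF lev]) (simp_all add: set_sortT length_sortT)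
  have "bitlen a + ?n * B \<le> ?Z + B * B" using L nB[of B] by linarith
  note P = mul_pow_time[OF this len_N]
  have "\<tau>' \<le> B * level_bound B U Q + 1"
    "snd (mul_powT a c ?n) \<le> B * (B + 1 + (?Z + B * B) * B) + 1"
    using L P(1) nB by (meson add_right_mono order_trans)+
  moreover have "l + (9 + t' + (s + x)) + (l + (m + (f + z))) \<le>
      2 * l' + (9 + U) + s' + x' + m' + 2 * ?Z + B * B"
    if "l \<le> l'" "t' \<le> U" "s \<le> s'" "x \<le> x'" "m \<le> m'" "f \<le> ?Z + B * B" "z \<le> ?Z"
    for l t' s x m f z l' s' x' m'
    using that by linarith
  ultimately show ?thesis
    using length_time sort_time L P(2) TU(2) unfolding \<tau> total_bound_def by blast
qed

end

end

section \<open>A polynomial bound in the length of the input\<close>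

text \<open>The next three lemmas move the step count from the natural numbers to the reals, replace its arguments by
  larger ones, and recognise the result as the value of a polynomial.\<close>

lemma of_nat_total_bound:
  "real (total_bound b u q) = total_bound (real b) (real u) (real q)"
  by (simp only: time_bound_defs of_nat_add of_nat_mult of_nat_numeral of_nat_1)

lemma poly_total_bound:
  "poly (total_bound p q r) x = total_bound (poly p x) (poly q x) (poly r x :: 'a::comm_semiring_1)"
  by (simp only: time_bound_defs poly_add poly_mult poly_numeral poly_1)

lemma total_bound_mono:
  assumes "0 \<le> b" "b \<le> b'" "0 \<le> u" "u \<le> u'" "0 \<le> q" "q \<le> (q'::real)"
  shows "total_bound b u q \<le> total_bound b' u' q'"
  unfolding time_bound_defs using assms
  by (intro add_mono mult_mono add_nonneg_nonneg mult_nonneg_nonneg order_refl) simp_all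

text \<open>The polynomial of the sampler need not be monotone, so it cannot be evaluated at an upper bound for the
  length of a query. Taking absolute values of the coefficients repairs this.\<close>

lemma poly_majorant:
  fixes p :: "real poly"
  obtains q where "\<And>x y. 0 \<le> x \<Longrightarrow> x \<le> y \<Longrightarrow> poly p x \<le> poly q y" "\<And>y. 0 \<le> y \<Longrightarrow> 0 \<le> poly q y"
proof -
  have "\<exists>q. (\<forall>x y. 0 \<le> x \<longrightarrow> x \<le> y \<longrightarrow> poly p x \<le> poly q y) \<and> (\<forall>y\<ge>0. 0 \<le> poly q y)"
  proof (induction p)
    case 0
    show ?case by (intro exI[of _ 0]) simp
  next
    case (pCons a p)
    then obtain q where q: "\<And>x y. 0 \<le> x \<Longrightarrow> x \<le> y \<Longrightarrow> poly p x \<le> poly q y"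
      "\<And>y. 0 \<le> y \<Longrightarrow> 0 \<le> poly q y" by blast
    have "a + x * poly p x \<le> \<bar>a\<bar> + y * poly q y" if "0 \<le> x" "x \<le> y" for x y
    proof -
      have "x * poly p x \<le> x * poly q y" using q(1)[OF that] that by (intro mult_left_mono)
      also have "\<dots> \<le> y * poly q y" using q(2)[of y] that by (intro mult_right_mono) auto
      finally show ?thesis by simp
    qed
    then show ?case using q(2) by (intro exI[of _ "pCons \<bar>a\<bar> q"]) simp
  qed
  then show thesis using that by blast
qed

lemma length_enc_nats: "length (enc_nats ns) = (\<Sum>n\<leftarrow>ns. bitlen n + 1)"
  by (simp add: enc_nats_def length_concat bitlen_def o_def)

lemma bitlen_le_enc_nats: "n \<in> set ns \<Longrightarrow> bitlen n \<le> length (enc_nats ns)"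
  by (induction ns) (auto simp: length_enc_nats)

lemma length_le_enc_nats: "length ns \<le> length (enc_nats ns)"
  by (induction ns) (simp_all add: length_enc_nats)

lemma enc_inst_bounds:
  assumes "L = length (enc_inst (vs, k, c))"
  shows "k < 2 ^ L" "c < 2 ^ L" "w \<in> set vs \<Longrightarrow> fst w < 2 ^ L \<and> snd w < 2 ^ L"
    "length vs \<le> L" "length (enc_query (vs, k, c) t) = L + bitlen t + 1"
proof -
  let ?ns = "k # c # concat (map (\<lambda>(i, j). [i, j]) vs)"
  have L: "L = length (enc_nats ?ns)" by (simp add: assms enc_inst_def)
  have less: "n < 2 ^ L" if "n \<in> set ?ns" for n
    using less_exp_bitlen[of n] bitlen_le_enc_nats[OF that] power_increasing[of "bitlen n" L "2::nat"]
    unfolding L by linarith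
  show "k < 2 ^ L" "c < 2 ^ L" by (auto intro: less)
  show "fst w < 2 ^ L \<and> snd w < 2 ^ L" if w: "w \<in> set vs"
  proof -
    have "set ?ns = {k, c} \<union> (\<Union>w\<in>set vs. {fst w, snd w})" by (simp add: case_prod_unfold)
    then have "fst w \<in> set ?ns" "snd w \<in> set ?ns" using w by blast+
    then show ?thesis using less by blast
  qed
  have "length vs \<le> length (concat (map (\<lambda>(i, j). [i, j]) vs))" by (induction vs) auto
  then show "length vs \<le> L" using length_le_enc_nats[of ?ns] L by simp
  show "length (enc_query (vs, k, c) t) = L + bitlen t + 1"
    by (simp add: L enc_query_def length_enc_nats)
qed

text \<open>The logarithm is at most \<open>2n + ln (1/\<delta>) \<le> 3X\<close> and the square at most \<open>X\<^sup>4\<close>; rounding up costs \<open>1\<close>.\<close>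

lemma T_sample_le:
  assumes "0 < \<epsilon>" "0 < \<delta>" "\<delta> < 1" "real n \<le> X" "1 / \<epsilon> \<le> X" "ln (1 / \<delta>) \<le> X"
  shows "real (T_sample n \<epsilon> \<delta>) \<le> 162 * X ^ 5 + 1"
proof (cases "n = 0")
  case True
  have "0 \<le> X" using assms by simp
  then show ?thesis using True by (simp add: T_sample_def)
next
  case False
  have L: "0 \<le> ln (2 * real n / \<delta>)" using False assms by (simp add: field_simps)
  have "ln (2 * real n / \<delta>) = ln (2 * real n) + ln (1 / \<delta>)" using False assms by (simp add: ln_div)
  also have "ln (2 * real n) \<le> 2 * real n - 1" using ln_le_minus_one[of "2 * real n"] False by simp
  finally have ln: "ln (2 * real n / \<delta>) \<le> 3 * X" using assms by linarith
  have "real n / \<epsilon> \<le> X * X" using mult_mono[of "real n" X "1 / \<epsilon>" X] assms by simp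
  then have "(real n / \<epsilon>)\<^sup>2 \<le> (X * X)\<^sup>2" using assms by (intro power_mono) auto
  then have "54 * (real n / \<epsilon>)\<^sup>2 * ln (2 * real n / \<delta>) \<le> 54 * (X * X)\<^sup>2 * (3 * X)"
    using ln L by (intro mult_mono) auto
  also have "\<dots> = 162 * X ^ 5" by (simp add: power2_eq_square eval_nat_numeral)
  finally have *: "54 * (real n / \<epsilon>)\<^sup>2 * ln (2 * real n / \<delta>) \<le> 162 * X ^ 5" .
  have "0 \<le> 54 * (real n / \<epsilon>)\<^sup>2 * ln (2 * real n / \<delta>)" using L by simp
  then show ?thesis unfolding T_sample_def using * by linarith
qed

lemma splitting_estimate_time:
  assumes S: "poly_time_uniform_sampler S"
  shows "\<exists>p :: real poly. \<forall>x\<in>instances. \<forall>\<epsilon> \<delta>. 0 < \<epsilon> \<and> 0 < \<delta> \<and> \<delta> < 1 \<longrightarrow>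
    (\<forall>(y, \<tau>) \<in> set_pmf (splitting_estimate S x \<epsilon> \<delta>).
       real \<tau> \<le> poly p (real (length (enc_inst x)) + 1 / \<epsilon> + ln (1 / \<delta>)))"
proof -
  from S obtain p0 :: "real poly" where p0: "\<And>vs k c t \<phi> \<tau>. (vs, k, c) \<in> instances \<Longrightarrow>
      t \<le> length vs \<Longrightarrow> (\<phi>, \<tau>) \<in> set_pmf (S (vs, k, c) t) \<Longrightarrow>
      real \<tau> \<le> poly p0 (real (length (enc_query (vs, k, c) t)))"
    unfolding poly_time_uniform_sampler_def by blast
  obtain q where q: "\<And>x y. 0 \<le> x \<Longrightarrow> x \<le> y \<Longrightarrow> poly p0 x \<le> poly q y" "\<And>y. 0 \<le> y \<Longrightarrow> 0 \<le> poly q y"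
    using poly_majorant[of p0] by blast
  define p where "p = total_bound [:2, 1:] (162 * [:0, 1:] ^ 5 + 2) (pcompose q [:2, 2:])"
  have "real \<tau> \<le> poly p (real (length (enc_inst x)) + 1 / \<epsilon> + ln (1 / \<delta>))"
    if x: "x \<in> instances" and \<epsilon>: "0 < \<epsilon>" and \<delta>: "0 < \<delta>" "\<delta> < 1"
      and out: "(z, \<tau>) \<in> set_pmf (splitting_estimate S x \<epsilon> \<delta>)" for x \<epsilon> \<delta> z \<tau>
  proof -
    obtain vs k c where xe: "x = (vs, k, c)" by (cases x)
    define L where "L = length (enc_inst (vs, k, c))"
    define X where "X = real L + 1 / \<epsilon> + ln (1 / \<delta>)"
    define T where "T = T_sample (length vs) \<epsilon> \<delta>"
    define Q where "Q = nat \<lfloor>poly q (2 * X + 2)\<rfloor>"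
    note enc = enc_inst_bounds[OF L_def]
    have "0 \<le> ln (1 / \<delta>)" using \<delta> by simp
    moreover have "0 \<le> 1 / \<epsilon>" using \<epsilon> by simp
    ultimately have LX: "real L \<le> X" and \<epsilon>X: "1 / \<epsilon> \<le> X" and \<delta>X: "ln (1 / \<delta>) \<le> X"
      unfolding X_def by linarith+
    have Q: "real Q \<le> poly q (2 * X + 2)" using q(2)[of "2 * X + 2"] LX by (simp add: Q_def)
    have S_time: "\<tau> \<le> Q" if "t \<le> length vs" "(\<phi>, \<tau>) \<in> set_pmf (S (vs, k, c) t)" for t \<phi> \<tau>
    proof -
      have "bitlen t \<le> L + 1" using bitlen_le_Suc[of t] that(1) enc(4) by simp
      then have "real (length (enc_query (vs, k, c) t)) \<le> 2 * X + 2" using LX by (simp add: enc(5))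
      with p0[OF x[unfolded xe] that] q(1) have "real \<tau> \<le> poly q (2 * X + 2)"
        by (meson of_nat_0_le_iff order_trans)
      then show ?thesis unfolding Q_def by linarith
    qed
    have S_col: "\<phi> \<in> colourings (set vs) c" if "t \<le> length vs" "(\<phi>, \<tau>) \<in> set_pmf (S (vs, k, c) t)" for t \<phi> \<tau>
    proof -
      have "fst ` set_pmf (S (vs, k, c) t) \<subseteq> colourings (set vs) c"
        using S x that(1) unfolding poly_time_uniform_sampler_def xe by fastforce
      then show ?thesis using that(2) by force
    qed
    have "\<tau> \<le> total_bound (L + 2) (T + 1) Q"
    proof (rule splitting_time[where N = "2 ^ L" and S = S and T = T, OF _ _ _ _ _ _ _ _ S_time S_col _ _ out[unfolded xe] T_def])
      show "2 * 2 ^ L < (2::nat) ^ (L + 2)" by simp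
      show "fst w \<le> 2 ^ L \<and> snd w \<le> 2 ^ L" if "w \<in> set vs" for w
        using enc(3)[OF that] by simp
      show "length vs \<le> 2 ^ L" using enc(4) less_exp[of L] by linarith
      show "bitlen T \<le> T + 1" using bitlen_le_Suc[of T] by simp
    qed (use enc in \<open>simp_all add: T_def\<close>)
    then have "real \<tau> \<le> total_bound (real (L + 2)) (real (T + 1)) (real Q)"
      by (simp only: of_nat_total_bound[symmetric] of_nat_le_iff)
    also have "\<dots> \<le> total_bound (X + 2) (162 * X ^ 5 + 2) (poly q (2 * X + 2))"
    proof (rule total_bound_mono)
      have "real (length vs) \<le> X" using LX enc(4) by linarith
      then have "real T \<le> 162 * X ^ 5 + 1"
        unfolding T_def using \<epsilon> \<delta> \<epsilon>X \<delta>X by (intro T_sample_le)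
      then show "real (T + 1) \<le> 162 * X ^ 5 + 2" by simp
    qed (use LX Q in simp_all)
    also have "\<dots> = poly p X"
      by (simp add: p_def poly_total_bound poly_pcompose poly_numeral algebra_simps)
    finally show ?thesis by (simp add: X_def L_def xe)
  qed
  then show ?thesis by blast
qed

section \<open>The approximation scheme\<close>

theorem theorem2:
  fixes S :: sampler
  assumes "poly_time_uniform_sampler S"
  shows "fpras instances enc_inst (\<lambda>(vs, k, c). num_stable (set vs) k c) (splitting_estimate S)"
  unfolding fpras_def
proof (intro conjI ballI allI impI)
  show "\<exists>p :: real poly. \<forall>x\<in>instances. \<forall>\<epsilon> \<delta>. 0 < \<epsilon> \<and> 0 < \<delta> \<and> \<delta> < 1 \<longrightarrow>
    (\<forall>(y, \<tau>) \<in> set_pmf (splitting_estimate S x \<epsilon> \<delta>).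
       real \<tau> \<le> poly p (real (length (enc_inst x)) + 1 / \<epsilon> + ln (1 / \<delta>)))"
    using assms by (rule splitting_estimate_time)
next
  fix x :: inst and \<epsilon> \<delta> :: real
  assume x: "x \<in> instances" and par: "0 < \<epsilon> \<and> \<epsilon> \<le> 1 \<and> 0 < \<delta> \<and> \<delta> < 1"
  obtain vs k c where xe: "x = (vs, k, c)" by (cases x)
  show "1 - \<delta> \<le> measure_pmf.prob (splitting_estimate S x \<epsilon> \<delta>)
    {(y, \<tau>). (1 - \<epsilon>) * real (case x of (vs, k, c) \<Rightarrow> num_stable (set vs) k c) \<le> y \<and>
      y \<le> (1 + \<epsilon>) * real (case x of (vs, k, c) \<Rightarrow> num_stable (set vs) k c)}"
    using estimate_accurate[OF assms x[unfolded xe], of \<epsilon> \<delta>] par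
    by (simp add: xe vimage_def case_prod_unfold)
qed

end
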